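(* Assume $\kappa$ is a singular strong limit cardinal of countable cofinality and $\mathrm{cf}(2^\kappa)=\kappa^+$. Let $\langle \kappa_n : n<\omega\rangle$ be any increasing sequence of regular cardinals cofinal in $\kappa$, and let $\langle \mathbb{P}_n : n<\omega\rangle$ be a sequence of non-trivial separative forcing notions such that each $\mathbb{P}_n$ is $\kappa_n$-closed and of size $<\kappa$. Further suppose that for each $n<\omega$ and each $\lambda<\kappa_n$, each decreasing sequence $\langle p_\alpha : \alpha<\lambda\rangle$ in $\mathbb{P}_n$ has a greatest lower bound in $\mathbb{P}_n$. Then forcing with the full product $\prod_{n<\omega}\mathbb{P}_n$ collapses $2^\kappa$ into $\kappa^+$.
   Context: Work in ZFC, with ground model $V$. A forcing notion is a partially ordered set with a largest element $1$, where smaller conditions are stronger. Non-trivial means that every condition has two incompatible extensions (i.e. the forcing is atomless). A forcing notion is $\kappa_n$-closed if every decreasing sequence of conditions of length less than $\kappa_n$ has a lower bound. The full product $\prod_{n<\omega}\mathbb{P}_n$ consists of all sequences $\langle p_n : n<\omega\rangle$ with $p_n\in\mathbb{P}_n$ for every $n$ (full support), ordered coordinatewise. A forcing notion in $V$ collapses $2^\kappa$ into $\kappa^+$ if it is forced by every condition that there is a surjection from $(\kappa^+)^V$ onto $(2^\kappa)^V$. *)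

theory Defs
  imports Main
begin

unbundle cardinal_syntax

section \<open>Cardinals\<close>

text \<open>
  Cardinals are the cardinal orders \<open>r\<close> (\<open>Card_order r\<close>) of the library. Such an \<open>r\<close> is a reflexive
  well-order, an element \<open>a\<close> of \<open>Field r\<close> stands for the ordinal with order type \<open>underS r a\<close>, and
  every ordinal below \<open>r\<close> arises in this way exactly once. The cardinal \<open>2^r\<close> is
  \<open>|Pow (Field r)|\<close>.
\<close>

definition strong_limit :: "'a rel \<Rightarrow> bool" where
  "strong_limit r \<longleftrightarrow> (\<forall>m :: 'a rel. Card_order m \<and> m <o r \<longrightarrow> |Pow (Field m)| <o r)"

definition has_cofinality :: "'a rel \<Rightarrow> 'b rel \<Rightarrow> bool" where
  "has_cofinality r s \<longleftrightarrow>
     (\<exists>A. A \<subseteq> Field r \<and> cofinal A r \<and> |A| =o s) \<and>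
     (\<forall>A. A \<subseteq> Field r \<and> cofinal A r \<longrightarrow> s \<le>o |A| )"

definition singular_card :: "'a rel \<Rightarrow> bool" where
  "singular_card r \<longleftrightarrow> Cinfinite r \<and> \<not> regularCard r"

definition regular_card :: "'a rel \<Rightarrow> bool" where
  "regular_card r \<longleftrightarrow> Cinfinite r \<and> regularCard r"

text \<open>
  \<open>ks\<close> is a strictly increasing sequence of cardinals below the limit cardinal \<open>k\<close> with supremum
  \<open>k\<close>. Every cardinal below \<open>k\<close> is represented on the type of \<open>k\<close>.
\<close>

definition increasing_cofinal_seq :: "(nat \<Rightarrow> 'a rel) \<Rightarrow> 'a rel \<Rightarrow> bool" where
  "increasing_cofinal_seq ks k \<longleftrightarrow>
     (\<forall>m n. m < n \<longrightarrow> ks m <o ks n) \<and>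
     (\<forall>n. ks n <o k) \<and>
     (\<forall>m :: 'a rel. Card_order m \<and> m <o k \<longrightarrow> (\<exists>n. m \<le>o ks n))"


section \<open>Forcing notions\<close>

text \<open>
  A forcing notion is given by its order relation \<open>P\<close>: \<open>(q, p) \<in> P\<close> means \<open>q \<le> p\<close>, i.e. \<open>q\<close> is the
  stronger condition. By reflexivity the set of conditions is \<open>Field P\<close>.
\<close>

definition is_top :: "'p rel \<Rightarrow> 'p \<Rightarrow> bool" where
  "is_top P m \<longleftrightarrow> m \<in> Field P \<and> (\<forall>p\<in>Field P. (p, m) \<in> P)"

definition forcing_notion :: "'p rel \<Rightarrow> bool" where
  "forcing_notion P \<longleftrightarrow> Partial_order P \<and> (\<exists>m. is_top P m)"

definition top_cond :: "'p rel \<Rightarrow> 'p" where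
  "top_cond P = (THE m. is_top P m)"

lemma top_cond_eq:
  assumes "forcing_notion P" "is_top P m"
  shows "top_cond P = m"
  unfolding top_cond_def
proof (rule the_equality)
  fix m' assume "is_top P m'"
  moreover have "antisym P"
    using assms(1) by (auto simp: forcing_notion_def partial_order_on_def)
  ultimately show "m' = m"
    using assms(2) by (auto simp: is_top_def dest: antisymD)
qed (fact assms(2))

definition compatible :: "'p rel \<Rightarrow> 'p \<Rightarrow> 'p \<Rightarrow> bool" where
  "compatible P p q \<longleftrightarrow> (\<exists>u. (u, p) \<in> P \<and> (u, q) \<in> P)"

definition nontrivial :: "'p rel \<Rightarrow> bool" where
  "nontrivial P \<longleftrightarrow>
     (\<forall>p\<in>Field P. \<exists>q q'. (q, p) \<in> P \<and> (q', p) \<in> P \<and> \<not> compatible P q q')"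

definition separative :: "'p rel \<Rightarrow> bool" where
  "separative P \<longleftrightarrow>
     (\<forall>p\<in>Field P. \<forall>q\<in>Field P. (p, q) \<notin> P \<longrightarrow> (\<exists>u. (u, p) \<in> P \<and> \<not> compatible P u q))"

text \<open>
  \<open>s\<close> restricted to \<open>underS r a\<close> is a (weakly) decreasing sequence of conditions whose length is the
  ordinal of \<open>a\<close>, which is below \<open>r\<close>.
\<close>

definition decreasing_seq :: "'p rel \<Rightarrow> 'a rel \<Rightarrow> 'a \<Rightarrow> ('a \<Rightarrow> 'p) \<Rightarrow> bool" where
  "decreasing_seq P r a s \<longleftrightarrow>
     (\<forall>b\<in>underS r a. s b \<in> Field P) \<and>
     (\<forall>b\<in>underS r a. \<forall>c\<in>underS r a. (b, c) \<in> r \<longrightarrow> (s c, s b) \<in> P)"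

definition is_lower_bound :: "'p rel \<Rightarrow> 'p set \<Rightarrow> 'p \<Rightarrow> bool" where
  "is_lower_bound P S m \<longleftrightarrow> m \<in> Field P \<and> (\<forall>x\<in>S. (m, x) \<in> P)"

definition is_greatest_lower_bound :: "'p rel \<Rightarrow> 'p set \<Rightarrow> 'p \<Rightarrow> bool" where
  "is_greatest_lower_bound P S m \<longleftrightarrow>
     is_lower_bound P S m \<and> (\<forall>l. is_lower_bound P S l \<longrightarrow> (l, m) \<in> P)"

definition closed_forcing :: "'a rel \<Rightarrow> 'p rel \<Rightarrow> bool" where
  "closed_forcing r P \<longleftrightarrow>
     (\<forall>a\<in>Field r. \<forall>s. decreasing_seq P r a s \<longrightarrow>
        (\<exists>m. is_lower_bound P (s ` underS r a) m))"

definition glb_closed_forcing :: "'a rel \<Rightarrow> 'p rel \<Rightarrow> bool" where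
  "glb_closed_forcing r P \<longleftrightarrow>
     (\<forall>a\<in>Field r. \<forall>s. decreasing_seq P r a s \<longrightarrow>
        (\<exists>m. is_greatest_lower_bound P (s ` underS r a) m))"

definition full_product :: "(nat \<Rightarrow> 'p rel) \<Rightarrow> (nat \<Rightarrow> 'p) rel" where
  "full_product P = {(p, q). \<forall>n. (p n, q n) \<in> P n}"

lemma Field_full_product:
  assumes "\<And>n. forcing_notion (P n)"
  shows "Field (full_product P) = {p. \<forall>n. p n \<in> Field (P n)}"
proof -
  have "(x, x) \<in> P n" if "x \<in> Field (P n)" for n x
    using assms[of n] that
    by (auto simp: forcing_notion_def partial_order_on_def preorder_on_def refl_on_def)
  then show ?thesis
    by (auto simp: full_product_def Field_def) blast+
qed

lemma forcing_notion_full_product: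
  assumes "\<And>n. forcing_notion (P n)"
  shows "forcing_notion (full_product P)"
proof -
  have po: "Partial_order (P n)" for n
    using assms by (simp add: forcing_notion_def)
  have "refl_on (Field (full_product P)) (full_product P)"
    unfolding refl_on_def Field_full_product[OF assms]
    using po by (auto simp: full_product_def partial_order_on_def preorder_on_def refl_on_def)
  moreover have "full_product P \<subseteq> Field (full_product P) \<times> Field (full_product P)"
    by (auto simp: Field_def)
  moreover have "trans (full_product P)"
  proof (rule transI)
    fix x y z assume *: "(x, y) \<in> full_product P" "(y, z) \<in> full_product P"
    have "(x n, z n) \<in> P n" for n
      using * po[of n]
      by (auto simp: full_product_def partial_order_on_def preorder_on_def dest: transD)
    then show "(x, z) \<in> full_product P" by (simp add: full_product_def)
  qed
  moreover have "antisym (full_product P)"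
  proof (rule antisymI)
    fix x y assume *: "(x, y) \<in> full_product P" "(y, x) \<in> full_product P"
    have "x n = y n" for n
      using * po[of n]
      by (auto simp: full_product_def partial_order_on_def dest: antisymD)
    then show "x = y" by (rule ext)
  qed
  ultimately have "Partial_order (full_product P)"
    by (simp add: partial_order_on_def preorder_on_def)
  moreover obtain m where "\<And>n. is_top (P n) (m n)"
    using assms unfolding forcing_notion_def by metis
  then have "is_top (full_product P) m"
    unfolding is_top_def Field_full_product[OF assms] by (auto simp: full_product_def)
  ultimately show ?thesis
    by (auto simp: forcing_notion_def)
qed


section \<open>Names and the forcing relation\<close>

text \<open>
  \<open>Name I x c\<close> is the name \<open>{(x i, c i) | i \<in> I}\<close>. As \<open>I\<close> is a set over the type \<open>'i\<close>, these are the
  names hereditarily of size at most the cardinality of \<open>'i\<close>; values of \<open>x\<close> and \<open>c\<close> outside \<open>I\<close>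
  are irrelevant. The constructor \<open>Empty\<close>, for the name \<open>{}\<close>, only serves to make the datatype
  inhabited. If \<open>'i\<close> is infinite and has at least as many elements as there are conditions, a
  function in the generic extension between two ordinals which are well-orders on \<open>'i\<close> has a nice
  name of this kind, so the restriction on the size of names loses no such function.
\<close>

datatype ('i, 'p) name =
    Empty
  | Name (idx: "'i set") (sub: "'i \<Rightarrow> ('i, 'p) name") (cond: "'i \<Rightarrow> 'p")
where
  "idx Empty = {}"

primrec is_name :: "'p rel \<Rightarrow> ('i, 'p) name \<Rightarrow> bool" where
  "is_name P Empty \<longleftrightarrow> True"
| "is_name P (Name I x c) \<longleftrightarrow> (\<forall>i\<in>I. c i \<in> Field P \<and> is_name P (x i))"

definition dense_below :: "'p rel \<Rightarrow> 'p \<Rightarrow> 'p set \<Rightarrow> bool" where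
  "dense_below P p D \<longleftrightarrow> (\<forall>q. (q, p) \<in> P \<longrightarrow> (\<exists>u\<in>D. (u, q) \<in> P))"

text \<open>
  The usual simultaneous recursion for \<open>p \<tturnstile> x = y\<close> and \<open>p \<tturnstile> x \<in> y\<close>, with the clause for membership
  substituted into the one for equality to make the recursion primitive; the equation in its usual
  form is \<open>forces_eq_iff\<close> below.
\<close>

primrec forces_eq :: "'p rel \<Rightarrow> ('i, 'p) name \<Rightarrow> ('i, 'p) name \<Rightarrow> 'p \<Rightarrow> bool" where
  "forces_eq P Empty = (\<lambda>y p.
     \<forall>j\<in>idx y. \<forall>q. (q, p) \<in> P \<and> (q, cond y j) \<in> P \<longrightarrow> dense_below P q {})"
| "forces_eq P (Name I x c) = (\<lambda>y p.
     (\<forall>i\<in>I. \<forall>q. (q, p) \<in> P \<and> (q, c i) \<in> P \<longrightarrow>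
        dense_below P q {u. \<exists>j\<in>idx y. (u, cond y j) \<in> P \<and> forces_eq P (x i) (sub y j) u}) \<and>
     (\<forall>j\<in>idx y. \<forall>q. (q, p) \<in> P \<and> (q, cond y j) \<in> P \<longrightarrow>
        dense_below P q {u. \<exists>i\<in>I. (u, c i) \<in> P \<and> forces_eq P (x i) (sub y j) u}))"

definition forces_mem :: "'p rel \<Rightarrow> ('i, 'p) name \<Rightarrow> ('i, 'p) name \<Rightarrow> 'p \<Rightarrow> bool" where
  "forces_mem P x y p \<longleftrightarrow>
     dense_below P p {u. \<exists>j\<in>idx y. (u, cond y j) \<in> P \<and> forces_eq P x (sub y j) u}"

lemma forces_eq_sym: "forces_eq P x y p \<longleftrightarrow> forces_eq P y x p"
proof (induction x arbitrary: y p)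
  case Empty
  show ?case
    by (cases y) auto
next
  case (Name I x c)
  show ?case
    by (cases y) (auto simp: Name.IH)
qed

lemma forces_eq_iff:
  "forces_eq P x y p \<longleftrightarrow>
     (\<forall>i\<in>idx x. \<forall>q. (q, p) \<in> P \<and> (q, cond x i) \<in> P \<longrightarrow> forces_mem P (sub x i) y q) \<and>
     (\<forall>j\<in>idx y. \<forall>q. (q, p) \<in> P \<and> (q, cond y j) \<in> P \<longrightarrow> forces_mem P (sub y j) x q)"
proof (cases x)
  case Empty
  then show ?thesis
    by (simp add: forces_mem_def)
next
  case (Name I z c)
  have "forces_eq P (z i) (sub y j) = forces_eq P (sub y j) (z i)" for i j
    by (rule ext) (rule forces_eq_sym)
  then show ?thesis
    unfolding Name by (simp add: forces_mem_def)
qed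

text \<open>Formulas of the forcing language, with names as parameters.\<close>

datatype ('i, 'p) fm =
    Mem "('i, 'p) name" "('i, 'p) name"
  | Eq "('i, 'p) name" "('i, 'p) name"
  | Neg "('i, 'p) fm"
  | Conj "('i, 'p) fm" "('i, 'p) fm"
  | Forall "('i, 'p) name \<Rightarrow> ('i, 'p) fm"

primrec forces :: "'p rel \<Rightarrow> ('i, 'p) fm \<Rightarrow> 'p \<Rightarrow> bool" where
  "forces P (Mem x y) = forces_mem P x y"
| "forces P (Eq x y) = forces_eq P x y"
| "forces P (Neg f) = (\<lambda>p. \<forall>q. (q, p) \<in> P \<longrightarrow> \<not> forces P f q)"
| "forces P (Conj f g) = (\<lambda>p. forces P f p \<and> forces P g p)"
| "forces P (Forall F) = (\<lambda>p. \<forall>x. is_name P x \<longrightarrow> forces P (F x) p)"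

definition Disj :: "('i, 'p) fm \<Rightarrow> ('i, 'p) fm \<Rightarrow> ('i, 'p) fm" where
  "Disj f g = Neg (Conj (Neg f) (Neg g))"

definition Imp :: "('i, 'p) fm \<Rightarrow> ('i, 'p) fm \<Rightarrow> ('i, 'p) fm" where
  "Imp f g = Neg (Conj f (Neg g))"

definition Iff :: "('i, 'p) fm \<Rightarrow> ('i, 'p) fm \<Rightarrow> ('i, 'p) fm" where
  "Iff f g = Conj (Imp f g) (Imp g f)"

definition Exi :: "(('i, 'p) name \<Rightarrow> ('i, 'p) fm) \<Rightarrow> ('i, 'p) fm" where
  "Exi F = Neg (Forall (\<lambda>x. Neg (F x)))"

definition AllIn :: "('i, 'p) name \<Rightarrow> (('i, 'p) name \<Rightarrow> ('i, 'p) fm) \<Rightarrow> ('i, 'p) fm" where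
  "AllIn a F = Forall (\<lambda>x. Imp (Mem x a) (F x))"

definition ExiIn :: "('i, 'p) name \<Rightarrow> (('i, 'p) name \<Rightarrow> ('i, 'p) fm) \<Rightarrow> ('i, 'p) fm" where
  "ExiIn a F = Exi (\<lambda>x. Conj (Mem x a) (F x))"

text \<open>\<open>z = {a, b}\<close>, and \<open>z = (a, b)\<close> as a Kuratowski pair.\<close>

definition UPair_fm :: "('i, 'p) name \<Rightarrow> ('i, 'p) name \<Rightarrow> ('i, 'p) name \<Rightarrow> ('i, 'p) fm" where
  "UPair_fm a b z = Forall (\<lambda>w. Iff (Mem w z) (Disj (Eq w a) (Eq w b)))"

definition Pair_fm :: "('i, 'p) name \<Rightarrow> ('i, 'p) name \<Rightarrow> ('i, 'p) name \<Rightarrow> ('i, 'p) fm" where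
  "Pair_fm a b z = Exi (\<lambda>u. Exi (\<lambda>v.
     Conj (UPair_fm a a u) (Conj (UPair_fm a b v) (UPair_fm u v z))))"

definition App_fm :: "('i, 'p) name \<Rightarrow> ('i, 'p) name \<Rightarrow> ('i, 'p) name \<Rightarrow> ('i, 'p) fm" where
  "App_fm f a b = ExiIn f (\<lambda>z. Pair_fm a b z)"

definition Function_fm :: "('i, 'p) name \<Rightarrow> ('i, 'p) name \<Rightarrow> ('i, 'p) name \<Rightarrow> ('i, 'p) fm" where
  "Function_fm f A B =
     Conj (AllIn f (\<lambda>z. ExiIn A (\<lambda>a. ExiIn B (\<lambda>b. Pair_fm a b z))))
    (Conj (AllIn A (\<lambda>a. ExiIn B (\<lambda>b. App_fm f a b)))
          (AllIn A (\<lambda>a. AllIn B (\<lambda>b. AllIn B (\<lambda>b'.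
             Imp (Conj (App_fm f a b) (App_fm f a b')) (Eq b b'))))))"

definition Surjection_fm :: "('i, 'p) name \<Rightarrow> ('i, 'p) name \<Rightarrow> ('i, 'p) name \<Rightarrow> ('i, 'p) fm" where
  "Surjection_fm f A B =
     Conj (Function_fm f A B) (AllIn B (\<lambda>b. ExiIn A (\<lambda>a. App_fm f a b)))"

text \<open>
  For a well-order \<open>r\<close>, \<open>check_elem P r a\<close> is the canonical (check) name of the von Neumann ordinal
  with order type \<open>underS r a\<close>, and \<open>check_ord P r\<close> that of the von Neumann ordinal with order type
  \<open>r\<close>, i.e. of the ground model cardinal if \<open>r\<close> is a cardinal order.
\<close>

definition check_elem :: "'p rel \<Rightarrow> 'i rel \<Rightarrow> 'i \<Rightarrow> ('i, 'p) name" where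
  "check_elem P r = wfrec (r - Id) (\<lambda>x a. Name (underS r a) x (\<lambda>_. top_cond P))"

definition check_ord :: "'p rel \<Rightarrow> 'i rel \<Rightarrow> ('i, 'p) name" where
  "check_ord P r = Name (Field r) (check_elem P r) (\<lambda>_. top_cond P)"

lemma check_elem_unfold:
  assumes "Well_order r"
  shows "idx (check_elem P r a) = underS r a"
    and "b \<in> underS r a \<Longrightarrow> sub (check_elem P r a) b = check_elem P r b"
    and "cond (check_elem P r a) b = top_cond P"
proof -
  have "wf (r - Id)"
    using assms by (simp add: well_order_on_def)
  note unfold = def_wfrec[OF eq_reflection[OF check_elem_def[of P r]] this, of a]
  show "idx (check_elem P r a) = underS r a" "cond (check_elem P r a) b = top_cond P"
    by (simp_all add: unfold)
  show "sub (check_elem P r a) b = check_elem P r b" if "b \<in> underS r a"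
    using that by (subst unfold) (auto simp: cut_def underS_def)
qed

text \<open>
  \<open>P\<close> collapses the ground model cardinal \<open>s\<close> into \<open>r\<close>: every condition forces that there is a
  surjection from \<open>r\<close> onto \<open>s\<close>.
\<close>

definition collapses :: "'p rel \<Rightarrow> 'i rel \<Rightarrow> 'i rel \<Rightarrow> bool" where
  "collapses P s r \<longleftrightarrow>
     (\<forall>p\<in>Field P. forces P (Exi (\<lambda>f. Surjection_fm f (check_ord P r) (check_ord P s))) p)"

end

theory Submission
  imports Defs
begin

text \<open>
  Call a condition \<open>q\<close> of the product almost stronger than \<open>p\<close>, in symbols \<open>q \<preceq>\<^sup>* p\<close>, if
  \<open>q n \<le> p n\<close> for all but finitely many \<open>n\<close>. A condition that is almost stronger than \<open>p\<close> becomes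
  stronger than \<open>p\<close> after finitely many changes, so whatever the order \<open>\<preceq>\<^sup>*\<close> collapses is collapsed
  by the product, and the argument takes place in \<open>\<preceq>\<^sup>*\<close>. Two features of this order matter.

  First, it is \<open>\<kappa>\<close>-distributive: \<open>\<kappa>\<close> many dense open sets have a common refinement below every
  condition. The order itself need not be closed, but comparing conditions only on the coordinates
  from \<open>N\<close> on gives a \<open>\<kappa>\<^sub>N\<close>-closed order, in which a transfinite chain meets fewer than \<open>\<kappa>\<^sub>N\<close> dense
  sets; a diagonal over \<open>N\<close> handles \<open>\<kappa>\<close> of them (\<open>distributive\<close>).

  Secondly, there are \<open>2\<^sup>\<kappa>\<close> pairwise incompatible conditions below each condition. Exhaust \<open>\<kappa>\<close> by
  increasing sets \<open>C n\<close> with \<open>2\<close> to the \<open>|C n|\<close> below \<open>\<kappa>\<^sub>n\<close>, choose an antichain of \<open>P n\<close> below \<open>p n\<close> indexed by the subsets of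
  \<open>C n\<close>, and attach to \<open>X \<subseteq> \<kappa>\<close> the sequence of the members with index \<open>X \<inter> C n\<close>. Different sets
  disagree from some coordinate on (\<open>large_antichain\<close>).

  As \<open>2\<^sup>\<kappa>\<close> has cofinality \<open>\<kappa>\<^sup>+\<close> and there are only \<open>2\<^sup>\<kappa>\<close> conditions, they form a union of sets
  \<open>Q i\<close>, \<open>i < \<kappa>\<^sup>+\<close>, of size less than \<open>2\<^sup>\<kappa>\<close>. By the second feature the conditions that lie above no
  member of \<open>Q i\<close> are dense. A maximal antichain \<open>A i\<close> of such conditions splits every
  \<open>q \<in> Q i\<close>: by separativity \<open>q\<close> is compatible with at least two of its members
  (\<open>splitting_antichain\<close>). Hence each condition is split by some \<open>A i\<close>. Iterating this along a tree of
  height \<open>\<omega>\<close> with \<open>2\<close> to the \<open>|C n|\<close> successors at the nodes of level \<open>n\<close> yields, below any \<open>q\<close>, a family of \<open>2\<^sup>\<kappa>\<close>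
  conditions any two of which are separated by one of only \<open>\<kappa>\<close> antichains (\<open>fusion\<close>). The indices of
  these antichains are bounded by some \<open>j < \<kappa>\<^sup>+\<close>. By distributivity a dense set of conditions decides for all \<open>i < j\<close> which
  member of \<open>A i\<close> lies in the generic filter; let the value at \<open>j\<close> be the sequence of these choices.
  Below \<open>q\<close> there are \<open>2\<^sup>\<kappa>\<close> possible values at \<open>j\<close>.

  Finally, for each \<open>j\<close> the possible values are labelled by subsets of \<open>\<kappa>\<close> in such a way that a
  condition with \<open>2\<^sup>\<kappa>\<close> possible values at \<open>j\<close> can be extended so as to get any prescribed label; this is
  a Bernstein-style choice of representatives (\<open>injective_choice\<close>, \<open>collapsing_labels\<close>). The
  function which sends \<open>j\<close> to the label of the value at \<open>j\<close> is then forced to be a surjection from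
  \<open>\<kappa>\<^sup>+\<close> onto \<open>2\<^sup>\<kappa>\<close> (\<open>collapses_if_labels\<close>).
\<close>

section \<open>Cardinal arithmetic\<close>

text \<open>
  This turns a set of size less than the length of \<open>r\<close> into a set of stages of a chain of conditions
  along a proper initial segment of \<open>r\<close>.
\<close>

lemma ordLess_imp_inj_underS:
  fixes r :: "'a rel" and Z :: "'z set"
  assumes "|Z| <o r"
  obtains a g where "a \<in> Field r" "inj_on g Z" "g ` Z \<subseteq> underS r a"
proof -
  obtain f where wo: "Well_order |Z|" "Well_order r" and f: "embed |Z| r f"
    and nb: "\<not> bij_betw f (Field |Z| ) (Field r)"
    using assms by (auto simp: ordLess_def embedS_def)
  have inj: "inj_on f Z"
    using embed_inj_on[OF wo(1) f] by (simp add: Field_card_of)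
  have "wo_rel.ofilter r (f ` Z)"
    using embed_Field_ofilter[OF wo f] by (simp add: Field_card_of)
  then have "(\<exists>a\<in>Field r. f ` Z = underS r a) \<or> f ` Z = Field r"
    using wo_rel.ofilter_underS_Field[of r "f ` Z"] wo(2) by (simp add: wo_rel_def)
  moreover have "f ` Z \<noteq> Field r"
    using nb inj by (simp add: bij_betw_def Field_card_of)
  ultimately obtain a where "a \<in> Field r" "f ` Z = underS r a"
    by blast
  then show ?thesis
    using that[of a f] inj by blast
qed

text \<open>
  Pick the representatives along a well-order of \<open>T\<close> of minimal length: before each stage fewer than
  \<open>|T|\<close>, hence fewer than \<open>|S t|\<close>, elements have been used.
\<close>

lemma injective_choice:
  fixes S :: "'t \<Rightarrow> 'v set"
  assumes T: "|T| \<le>o |M|" and S: "\<And>t. t \<in> T \<Longrightarrow> |M| \<le>o |S t|"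
  obtains g where "inj_on g T" "\<And>t. t \<in> T \<Longrightarrow> g t \<in> S t"
proof -
  have wo: "Well_order |T|" and Field: "Field |T| = T"
    using card_of_Well_order[of T] by (simp_all add: Field_card_of)
  have wf: "wf ( |T| - Id)" and tot: "Total |T|"
    using wo by (auto simp: well_order_on_def linear_order_on_def)
  define g where "g = wfrec ( |T| - Id) (\<lambda>f t. SOME x. x \<in> S t \<and> x \<notin> f ` underS |T| t)"
  have g: "g t = (SOME x. x \<in> S t \<and> x \<notin> g ` underS |T| t)" for t
  proof -
    have "cut g ( |T| - Id) t ` underS |T| t = g ` underS |T| t"
      by (rule image_cong[OF refl]) (auto simp: cut_def underS_def)
    then show ?thesis
      by (subst def_wfrec[OF eq_reflection[OF g_def] wf]) simp
  qed
  have new: "g t \<in> S t \<and> g t \<notin> g ` underS |T| t" if t: "t \<in> T" for t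
  proof -
    have "|g ` underS |T| t| \<le>o |underS |T| t|" by (rule card_of_image)
    also have "|underS |T| t| <o |T|"
      by (rule card_of_underS) (simp_all add: Field t card_of_card_order_on)
    finally have "|g ` underS |T| t| <o |S t|"
      using ordLess_ordLeq_trans[OF _ ordLeq_transitive[OF T S[OF t]]] by blast
    then have "\<not> S t \<subseteq> g ` underS |T| t"
      using card_of_mono1 not_ordLess_ordLeq by blast
    then have "\<exists>x. x \<in> S t \<and> x \<notin> g ` underS |T| t" by blast
    then show ?thesis unfolding g[of t] by (rule someI_ex)
  qed
  have "inj_on g T"
  proof (rule inj_onI, rule ccontr)
    fix x y assume xy: "x \<in> T" "y \<in> T" "g x = g y" "x \<noteq> y"
    then have "x \<in> underS |T| y \<or> y \<in> underS |T| x"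
      using tot Field by (auto simp: underS_def total_on_def)
    then show False
      using new xy by (metis imageI)
  qed
  then show ?thesis using that new by blast
qed

lemma bounded_in_cardSuc:
  fixes \<kappa> :: "'a rel"
  assumes \<kappa>: "Card_order \<kappa>" "infinite (Field \<kappa>)"
    and J: "J \<subseteq> Field (cardSuc \<kappa>)" "|J| \<le>o \<kappa>"
  obtains j where "j \<in> Field (cardSuc \<kappa>)" "J \<subseteq> underS (cardSuc \<kappa>) j"
proof -
  let ?r = "cardSuc \<kappa>"
  have r: "Card_order ?r" by (rule cardSuc_Card_order[OF \<kappa>(1)])
  have tr: "trans ?r" and anti: "antisym ?r" and tot: "Total ?r" and refl: "Refl ?r"
    using r by (auto simp: card_order_on_def well_order_on_def linear_order_on_def
      partial_order_on_def preorder_on_def)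
  have inf: "infinite (Field ?r)"
    using \<kappa> by (simp add: cardSuc_finite)
  have "|J| <o ?r"
    by (rule ordLeq_ordLess_trans[OF J(2) cardSuc_greater[OF \<kappa>(1)]])
  then have "\<not> cofinal J ?r"
    using infinite_cardSuc_regularCard[OF \<kappa>(2,1)] J(1) not_ordLess_ordIso
    unfolding regularCard_def by blast
  then obtain a where a: "a \<in> Field ?r" "\<And>b. b \<in> J \<Longrightarrow> a \<noteq> b \<Longrightarrow> (a, b) \<notin> ?r"
    unfolding cofinal_def by blast
  obtain j where j: "j \<in> Field ?r" "a \<noteq> j" "(a, j) \<in> ?r"
    using infinite_Card_order_limit[OF r inf a(1)] by blast
  have "b \<in> underS ?r j" if b: "b \<in> J" for b
  proof -
    have "(b, a) \<in> ?r"
    proof (cases "a = b")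
      case True
      then show ?thesis using refl a(1) by (auto simp: refl_on_def)
    next
      case False
      then show ?thesis using tot a b J(1) unfolding total_on_def by blast
    qed
    then show ?thesis
      using j tr anti unfolding underS_def by (auto dest: transD antisymD)
  qed
  with j(1) that show ?thesis by blast
qed

text \<open>
  Inject \<open>X\<close> into \<open>M\<close> and cut along a cofinal set: proper initial segments of the cardinal \<open>|M|\<close>
  are smaller than \<open>|M|\<close>.
\<close>

lemma cofinality_cover:
  assumes cof: "has_cofinality |M| r" and r: "Card_order r" and X: "|X| \<le>o |M|"
  obtains Q where "\<And>i. i \<in> Field r \<Longrightarrow> Q i \<subseteq> X" "\<And>i. i \<in> Field r \<Longrightarrow> |Q i| <o |M|"
    "X \<subseteq> (\<Union>i\<in>Field r. Q i)"
proof -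
  obtain A where A: "A \<subseteq> M" "cofinal A |M|" "|A| =o r"
    using cof by (auto simp: has_cofinality_def Field_card_of)
  have "|A| =o |Field r|"
    using A(3) card_of_Field_ordIso[OF r] ordIso_symmetric ordIso_transitive by blast
  then obtain h where h: "bij_betw h (Field r) A"
    using card_of_ordIso bij_betw_inv by blast
  obtain e where e: "inj_on e X" "e ` X \<subseteq> M"
    using X unfolding card_of_ordLeq[symmetric] by blast
  define Q where "Q i = {x \<in> X. e x \<in> underS |M| (h i)}" for i
  show ?thesis
  proof (rule that[of Q])
    show "Q i \<subseteq> X" for i by (auto simp: Q_def)
    show "|Q i| <o |M|" if "i \<in> Field r" for i
    proof -
      have "|Q i| \<le>o |underS |M| (h i)|"
        unfolding card_of_ordLeq[symmetric]
        by (rule exI[of _ e]) (auto simp: Q_def intro: inj_on_subset[OF e(1)])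
      moreover have "h i \<in> Field |M|"
        using h A(1) that by (auto simp: bij_betw_def Field_card_of)
      then have "|underS |M| (h i)| <o |M|"
        by (rule card_of_underS[rotated]) (rule card_of_Card_order)
      ultimately show ?thesis by (rule ordLeq_ordLess_trans)
    qed
    show "X \<subseteq> (\<Union>i\<in>Field r. Q i)"
    proof
      fix x assume x: "x \<in> X"
      then have "e x \<in> Field |M|" using e(2) by (auto simp: Field_card_of)
      then obtain b where "b \<in> A" "e x \<in> underS |M| b"
        using A(2) by (auto simp: cofinal_def underS_def)
      then show "x \<in> (\<Union>i\<in>Field r. Q i)"
        using h x by (auto simp: Q_def bij_betw_def)
    qed
  qed
qed

text \<open>
  This is the bound \<open>\<kappa>\<^sup>\<omega> \<le> 2\<^sup>\<kappa>\<close>: a sequence is coded by its graph, a subset of \<open>\<nat> \<times> K\<close>, and that set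
  is no larger than \<open>K\<close>.
\<close>

lemma card_of_countable_product:
  fixes F :: "nat \<Rightarrow> 'p set" and K :: "'a set"
  assumes K: "infinite K" and F: "\<And>n. |F n| \<le>o |K|"
  shows "|{p. \<forall>n. p n \<in> F n}| \<le>o |Pow K|"
proof -
  have "\<forall>n. \<exists>e. inj_on e (F n) \<and> e ` F n \<subseteq> K"
    using F unfolding card_of_ordLeq by blast
  then obtain e where e: "\<And>n. inj_on (e n) (F n)" "\<And>n. e n ` F n \<subseteq> K"
    by metis
  have e_K: "e n x \<in> K" if "x \<in> F n" for n x
    using e(2)[of n] that by blast
  have "|(UNIV :: nat set) \<times> K| \<le>o |K|"
    using K by (intro card_of_Times_ordLeq_infinite_Field)
      (simp_all add: Field_card_of card_of_card_order_on infinite_iff_card_of_nat card_of_refl ordIso_imp_ordLeq)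
  then obtain h where h: "inj_on h ((UNIV :: nat set) \<times> K)" "h ` (UNIV \<times> K) \<subseteq> K"
    unfolding card_of_ordLeq[symmetric] by blast
  let ?g = "\<lambda>p. (\<lambda>n. h (n, e n (p n))) ` UNIV"
  let ?X = "{p. \<forall>n. p n \<in> F n}"
  have "inj_on ?g ?X"
  proof (rule inj_onI)
    fix p q assume p: "p \<in> ?X" and q: "q \<in> ?X" and eq: "?g p = ?g q"
    show "p = q"
    proof
      fix n
      have "h (n, e n (p n)) \<in> ?g q" unfolding eq[symmetric] by blast
      then obtain m where m: "h (n, e n (p n)) = h (m, e m (q m))" by blast
      have "(n, e n (p n)) \<in> UNIV \<times> K" "(m, e m (q m)) \<in> UNIV \<times> K"
        using p q e_K by auto
      then have "(n, e n (p n)) = (m, e m (q m))"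
        using inj_onD[OF h(1) m] by blast
      then show "p n = q n"
        using p q inj_onD[OF e(1)[of n]] by auto
    qed
  qed
  moreover have "?g ` ?X \<subseteq> Pow K"
  proof -
    have "h (n, e n (p n)) \<in> K" if "p \<in> ?X" for p n
    proof -
      have "(n, e n (p n)) \<in> UNIV \<times> K" using that e_K by auto
      then show ?thesis using h(2) by blast
    qed
    then show ?thesis by auto
  qed
  ultimately show ?thesis
    unfolding card_of_ordLeq[symmetric] by blast
qed

text \<open>
  Initial segments \<open>B m\<close> of size at least \<open>\<kappa>s m\<close> exhaust \<open>\<kappa>\<close>, but their power sets may exceed
  \<open>\<kappa>s m\<close>. As \<open>\<kappa>\<close> is a strong limit, each of these power sets is smaller than a later \<open>\<kappa>s n\<close>, so it suffices to
  delay: \<open>C n\<close> is the largest of the finitely many segments \<open>B m\<close> with \<open>m \<le> n\<close> whose power set is smaller than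
  \<open>\<kappa>s n\<close>, or empty if there is none.
\<close>

lemma strong_limit_filtration:
  fixes \<kappa> :: "'a rel"
  assumes \<kappa>: "Card_order \<kappa>" and lim: "strong_limit \<kappa>"
    and \<kappa>s: "\<And>n. Card_order (\<kappa>s n)" "\<And>n. infinite (Field (\<kappa>s n))"
    and seq: "increasing_cofinal_seq \<kappa>s \<kappa>"
  obtains C where "\<And>m n. m \<le> n \<Longrightarrow> C m \<subseteq> C n" "(\<Union>n. C n) = Field \<kappa>"
    "\<And>n. |Pow (C n)| <o \<kappa>s n"
proof -
  have tr: "trans \<kappa>" and anti: "antisym \<kappa>" and tot: "Total \<kappa>"
    using \<kappa> by (auto simp: card_order_on_def well_order_on_def linear_order_on_def
      partial_order_on_def preorder_on_def)
  have underS_mono: "underS \<kappa> x \<subseteq> underS \<kappa> y" if "(x, y) \<in> \<kappa>" for x y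
    using that tr anti by (auto simp: underS_def dest: transD antisymD)
  have less: "\<kappa>s m <o \<kappa>s n" if "m < n" for m n
    using seq that by (auto simp: increasing_cofinal_seq_def)
  have leq: "\<kappa>s m \<le>o \<kappa>s n" if "m \<le> n" for m n
    using less[of m n] that \<kappa>s(1)[of n]
    by (cases "m = n") (auto simp: ordLess_imp_ordLeq card_order_on_def ordLeq_reflexive)
  have "\<exists>a\<in>Field \<kappa>. |Field (\<kappa>s n)| \<le>o |underS \<kappa> a|" for n
  proof -
    have "|Field (\<kappa>s n)| <o \<kappa>"
      by (rule ordIso_ordLess_trans[OF card_of_Field_ordIso[OF \<kappa>s(1)]])
        (use seq in \<open>simp add: increasing_cofinal_seq_def\<close>)
    from ordLess_imp_inj_underS[OF this] obtain a g
      where "a \<in> Field \<kappa>" "inj_on g (Field (\<kappa>s n))" "g ` Field (\<kappa>s n) \<subseteq> underS \<kappa> a" .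
    then show ?thesis
      unfolding card_of_ordLeq[symmetric] by blast
  qed
  then obtain a where a: "\<And>n. a n \<in> Field \<kappa>" "\<And>n. |Field (\<kappa>s n)| \<le>o |underS \<kappa> (a n)|"
    by metis
  define B where "B n = underS \<kappa> (a n)" for n
  have B_cmp: "B m \<subseteq> B n \<or> B n \<subseteq> B m" for m n
  proof (cases "a m = a n")
    case False
    then have "(a m, a n) \<in> \<kappa> \<or> (a n, a m) \<in> \<kappa>"
      using tot a(1) by (auto simp: total_on_def)
    then show ?thesis
      using underS_mono unfolding B_def by blast
  qed (simp add: B_def)
  have cover: "\<exists>n. |Y| \<le>o \<kappa>s n" if Y: "|Y| <o \<kappa>" for Y :: "'y set"
  proof -
    obtain S where S: "S \<subseteq> Field \<kappa>" "|Y| =o |S|"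
      using iffD1[OF internalize_card_of_ordLeq ordLess_imp_ordLeq[OF Y]] by blast
    have "|S| <o \<kappa>" by (rule ordIso_ordLess_trans[OF ordIso_symmetric[OF S(2)] Y])
    then obtain n where "|S| \<le>o \<kappa>s n"
      using seq card_of_Card_order[of S] unfolding increasing_cofinal_seq_def by blast
    then have "|Y| \<le>o \<kappa>s n"
      by (rule ordIso_ordLeq_trans[OF S(2)])
    then show ?thesis ..
  qed
  have B_less: "|B n| <o \<kappa>" for n
    unfolding B_def by (rule card_of_underS[OF \<kappa> a(1)])
  have B_Un: "\<exists>n. b \<in> B n" if b: "b \<in> Field \<kappa>" for b
  proof -
    obtain n where n: "|underS \<kappa> b| \<le>o \<kappa>s n"
      using cover[OF card_of_underS[OF \<kappa> b]] by blast
    have "\<kappa>s (Suc n) \<le>o |B (Suc n)|"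
      unfolding B_def
      by (rule ordIso_ordLeq_trans[OF ordIso_symmetric[OF card_of_Field_ordIso[OF \<kappa>s(1)]] a(2)])
    then have lt: "|underS \<kappa> b| <o |B (Suc n)|"
      by (rule ordLess_ordLeq_trans[OF ordLeq_ordLess_trans[OF n less[OF lessI]]])
    have "\<not> underS \<kappa> (a (Suc n)) \<subseteq> underS \<kappa> b"
      using lt card_of_mono1 not_ordLess_ordLeq unfolding B_def by blast
    then have "b \<noteq> a (Suc n)" "(a (Suc n), b) \<notin> \<kappa>"
      using underS_mono by blast+
    then have "(b, a (Suc n)) \<in> \<kappa>"
      using tot a(1) b unfolding total_on_def by metis
    then show ?thesis
      using \<open>b \<noteq> a (Suc n)\<close> unfolding B_def underS_def by blast
  qed
  define G where "G n = B ` {m. m \<le> n \<and> |Pow (B m)| <o \<kappa>s n}" for n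
  define C where "C n = \<Union> (G n)" for n
  show ?thesis
  proof (rule that[of C])
    show "C m \<subseteq> C n" if "m \<le> n" for m n
    proof
      fix x assume "x \<in> C m"
      then obtain k where k: "k \<le> m" "|Pow (B k)| <o \<kappa>s m" "x \<in> B k"
        by (auto simp: C_def G_def)
      then show "x \<in> C n"
        using ordLess_ordLeq_trans[OF k(2) leq[OF that]] le_trans[OF k(1) that]
        by (auto simp: C_def G_def)
    qed
    show "(\<Union>n. C n) = Field \<kappa>"
    proof (rule set_eqI, rule iffI)
      fix b assume "b \<in> (\<Union>n. C n)"
      then show "b \<in> Field \<kappa>"
        by (auto simp: C_def G_def B_def underS_def Field_def)
    next
      fix b assume "b \<in> Field \<kappa>"
      then obtain m where m: "b \<in> B m" using B_Un by blast
      have "|Pow (Field |B m| )| <o \<kappa>"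
        using lim[unfolded strong_limit_def, rule_format, of "|B m|"] B_less[of m]
          card_of_Card_order[of "B m"] by blast
      then have "|Pow (B m)| <o \<kappa>" by (simp add: Field_card_of)
      then obtain n where "|Pow (B m)| \<le>o \<kappa>s n" using cover by blast
      then have "|Pow (B m)| <o \<kappa>s (max m (Suc n))"
        by (rule ordLeq_ordLess_trans[OF _ less]) simp
      then have "b \<in> C (max m (Suc n))"
        using m unfolding C_def G_def by (intro UnionI[of "B m"] imageI CollectI conjI) simp_all
      then show "b \<in> (\<Union>n. C n)" by blast
    qed
    show "|Pow (C n)| <o \<kappa>s n" for n
    proof (cases "G n = {}")
      case True
      have "Well_order (\<kappa>s n)" using \<kappa>s(1) by (simp add: card_order_on_def)
      then show ?thesis
        by (rule finite_ordLess_infinite[OF card_of_Well_order])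
          (simp_all add: Field_card_of C_def True \<kappa>s(2))
    next
      case False
      have "subset.chain UNIV (G n)"
        using B_cmp by (auto simp: subset_chain_def G_def)
      then have "C n \<in> G n"
        unfolding C_def by (intro Union_in_chain[OF _ False]) (auto simp: G_def)
      then show ?thesis by (auto simp: G_def)
    qed
  qed
qed

section \<open>Transfinite chains of conditions\<close>

text \<open>
  A descent of length less than \<open>r\<close> below \<open>q\<close>: \<open>u b\<close> is a lower bound of everything chosen before
  stage \<open>b\<close>, and \<open>w b\<close> a further extension that performs the task \<open>St\<close> of this stage. Closure keeps the
  descent going at limits and gives the final lower bound \<open>m\<close>.
\<close>

lemma closed_chain:
  fixes R :: "'p rel" and r :: "'a rel"
  assumes r: "Well_order r" and cl: "closed_forcing r R" and tr: "trans R"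
    and refl: "\<And>p. p \<in> Field R \<Longrightarrow> (p, p) \<in> R"
    and a: "a \<in> Field r" and q: "q \<in> Field R"
    and step: "\<And>b u. b \<in> underS r a \<Longrightarrow> (u, q) \<in> R \<Longrightarrow> \<exists>w. (w, u) \<in> R \<and> St b u w"
  obtains u w m where
    "\<And>b. b \<in> underS r a \<Longrightarrow> (u b, q) \<in> R \<and> (w b, u b) \<in> R \<and> St b (u b) (w b)"
    "\<And>b c. b \<in> underS r a \<Longrightarrow> c \<in> underS r b \<Longrightarrow> (u b, w c) \<in> R"
    "(m, q) \<in> R" "\<And>b. b \<in> underS r a \<Longrightarrow> (m, w b) \<in> R"
proof -
  have wf: "wf (r - Id)" and tr_r: "trans r" and anti: "antisym r"
    using r by (auto simp: well_order_on_def linear_order_on_def partial_order_on_def preorder_on_def)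
  have underS_trans: "d \<in> underS r b" if "d \<in> underS r c" "c \<in> underS r b" for b c d
    using that tr_r anti by (auto simp: underS_def dest: transD antisymD)
  \<comment> \<open>At the first stage nothing has been chosen yet; the lower bound is then \<open>q\<close> itself.\<close>
  have lower: "\<exists>m. (m, q) \<in> R \<and> (\<forall>b\<in>underS r x. (m, s b) \<in> R)"
    if x: "x \<in> Field r" and s: "\<And>b. b \<in> underS r x \<Longrightarrow> (s b, q) \<in> R"
      and dec: "\<And>b c. b \<in> underS r x \<Longrightarrow> c \<in> underS r b \<Longrightarrow> (s b, s c) \<in> R" for x s
  proof (cases "underS r x = {}")
    case True
    then show ?thesis using refl[OF q] by blast
  next
    case False
    have sF: "s b \<in> Field R" if "b \<in> underS r x" for b
      using s[OF that] by (auto simp: Field_def)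
    have "(s c, s b) \<in> R" if "b \<in> underS r x" "c \<in> underS r x" "(b, c) \<in> r" for b c
    proof (cases "b = c")
      case True
      then show ?thesis using refl sF that by blast
    next
      case False
      then show ?thesis using dec[OF that(2), of b] that by (auto simp: underS_def)
    qed
    then have "decreasing_seq R r x s"
      using sF by (auto simp: decreasing_seq_def)
    then obtain m where m: "\<forall>b\<in>underS r x. (m, s b) \<in> R"
      using cl x unfolding closed_forcing_def is_lower_bound_def by blast
    moreover have "(m, q) \<in> R"
      using m False s tr by (meson ex_in_conv transD)
    ultimately show ?thesis by blast
  qed
  define lb where "lb f b = (SOME m. (m, q) \<in> R \<and> (\<forall>c\<in>underS r b. (m, f c) \<in> R))" for f b
  define w where "w = wfrec (r - Id) (\<lambda>f b. SOME x. (x, lb f b) \<in> R \<and> St b (lb f b) x)"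
  have w: "w b = (SOME x. (x, lb w b) \<in> R \<and> St b (lb w b) x)" for b
  proof -
    have "lb (cut w (r - Id) b) b = lb w b"
      unfolding lb_def by (intro arg_cong[of _ _ Eps] ext conj_cong ball_cong refl)
        (auto simp: cut_def underS_def)
    then show ?thesis
      by (subst def_wfrec[OF eq_reflection[OF w_def] wf]) simp
  qed
  have lb: "(lb w x, q) \<in> R \<and> (\<forall>c\<in>underS r x. (lb w x, w c) \<in> R)"
    if "x \<in> Field r" "\<And>b. b \<in> underS r x \<Longrightarrow> (w b, q) \<in> R"
      "\<And>b c. b \<in> underS r x \<Longrightarrow> c \<in> underS r b \<Longrightarrow> (w b, w c) \<in> R" for x
    unfolding lb_def using lower[OF that] by (rule someI_ex)
  have Field: "b \<in> Field r" if "b \<in> underS r x" for b x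
    using that by (auto simp: underS_def Field_def)
  define Q where "Q b \<longleftrightarrow> (lb w b, q) \<in> R \<and> (w b, lb w b) \<in> R \<and> St b (lb w b) (w b) \<and>
      (\<forall>c\<in>underS r b. (lb w b, w c) \<in> R)" for b
  have Q_q: "(w b, q) \<in> R" and Q_w: "c \<in> underS r b \<Longrightarrow> (w b, w c) \<in> R" if "Q b" for b c
    using that tr unfolding Q_def by (meson transD)+
  have Q: "Q b" if "b \<in> underS r a" for b
    using wf that
  proof (induction b rule: wf_induct_rule)
    case (less b)
    have IH: "Q c" if "c \<in> underS r b" for c
    proof (rule less.IH)
      show "(c, b) \<in> r - Id" using that by (auto simp: underS_def)
      show "c \<in> underS r a" using that less.prems by (rule underS_trans)
    qed
    have 1: "(lb w b, q) \<in> R \<and> (\<forall>c\<in>underS r b. (lb w b, w c) \<in> R)"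
      by (rule lb) (use Field[OF less.prems] IH Q_q Q_w in blast)+
    then have "(w b, lb w b) \<in> R \<and> St b (lb w b) (w b)"
      unfolding w[of b] using step[OF less.prems] by (intro someI_ex[of "\<lambda>x. _ x \<and> _ x"]) blast
    with 1 show ?case by (simp add: Q_def)
  qed
  have "(lb w a, q) \<in> R \<and> (\<forall>c\<in>underS r a. (lb w a, w c) \<in> R)"
    by (rule lb) (use a Q Q_q Q_w in blast)+
  then show ?thesis
    using that[of "lb w" w "lb w a"] Q unfolding Q_def by blast
qed

text \<open>
  Descend along a chain and at every stage \<open>b\<close> split the current condition into two separated parts,
  continuing below \<open>w b\<close> and leaving \<open>s b\<close> aside. Everything left aside later lies below \<open>w b\<close> and so
  is separated from \<open>s b\<close>.
\<close>

lemma closed_splitting_family: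
  fixes R :: "'p rel" and r :: "'a rel" and Z :: "'z set"
  assumes r: "Well_order r" and cl: "closed_forcing r R" and tr: "trans R"
    and refl: "\<And>p. p \<in> Field R \<Longrightarrow> (p, p) \<in> R"
    and q: "q \<in> Field R" and Z: "|Z| <o r"
    and split: "\<And>u. (u, q) \<in> R \<Longrightarrow> \<exists>w s. (w, u) \<in> R \<and> (s, u) \<in> R \<and> Sep w s"
    and sym: "\<And>w s. Sep w s \<Longrightarrow> Sep s w"
    and down: "\<And>w w' s. Sep w s \<Longrightarrow> (w', w) \<in> R \<Longrightarrow> Sep w' s"
  obtains f where "\<And>z. z \<in> Z \<Longrightarrow> (f z, q) \<in> R"
    "\<And>z z'. z \<in> Z \<Longrightarrow> z' \<in> Z \<Longrightarrow> z \<noteq> z' \<Longrightarrow> Sep (f z) (f z')"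
proof -
  obtain a g where a: "a \<in> Field r" and g: "inj_on g Z" "g ` Z \<subseteq> underS r a"
    using ordLess_imp_inj_underS[OF Z] .
  have tot: "Total r"
    using r by (auto simp: well_order_on_def linear_order_on_def)
  obtain u w m where
    uw: "\<And>b. b \<in> underS r a \<Longrightarrow> (u b, q) \<in> R \<and> (w b, u b) \<in> R \<and>
          (\<exists>s. (s, u b) \<in> R \<and> Sep (w b) s)"
    and dec: "\<And>b c. b \<in> underS r a \<Longrightarrow> c \<in> underS r b \<Longrightarrow> (u b, w c) \<in> R"
    by (rule closed_chain[OF r cl tr refl a q, where St = "\<lambda>b u w. \<exists>s. (s, u) \<in> R \<and> Sep w s"])
       (use split in blast)+
  obtain s where s: "\<And>b. b \<in> underS r a \<Longrightarrow> (s b, u b) \<in> R \<and> Sep (w b) (s b)"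
    using uw by metis
  have lt: "Sep (s b) (s c)" if "b \<in> underS r a" "c \<in> underS r a" "c \<in> underS r b" for b c
  proof -
    have "(s b, w c) \<in> R"
      using s[OF that(1)] dec[OF that(1,3)] tr by (meson transD)
    then show ?thesis
      using down s[OF that(2)] by blast
  qed
  have ne: "Sep (s b) (s c)" if "b \<in> underS r a" "c \<in> underS r a" "b \<noteq> c" for b c
  proof -
    have "c \<in> underS r b \<or> b \<in> underS r c"
      using that tot by (auto simp: underS_def total_on_def Field_def)
    then show ?thesis
      using lt that sym by blast
  qed
  show ?thesis
  proof (rule that[of "s \<circ> g"])
    fix z assume "z \<in> Z"
    then have "g z \<in> underS r a" using g by blast
    then show "((s \<circ> g) z, q) \<in> R"
      using s uw tr unfolding comp_def by (meson transD)
  next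
    fix z z' assume "z \<in> Z" "z' \<in> Z" "z \<noteq> z'"
    then show "Sep ((s \<circ> g) z) ((s \<circ> g) z')"
      using g by (auto intro!: ne dest: inj_onD)
  qed
qed

text \<open>
  A chain whose stage \<open>g z\<close> enters the set \<open>D z\<close>; its lower bound then lies in all of these sets.
\<close>

lemma closed_distributive:
  fixes R :: "'p rel" and r :: "'a rel" and Z :: "'z set"
  assumes r: "Well_order r" and cl: "closed_forcing r R" and tr: "trans R"
    and refl: "\<And>p. p \<in> Field R \<Longrightarrow> (p, p) \<in> R"
    and q: "q \<in> Field R" and Z: "|Z| <o r"
    and dense: "\<And>z u. z \<in> Z \<Longrightarrow> (u, q) \<in> R \<Longrightarrow> \<exists>w\<in>D z. (w, u) \<in> R"
    and opn: "\<And>z w w'. z \<in> Z \<Longrightarrow> w \<in> D z \<Longrightarrow> (w', w) \<in> R \<Longrightarrow> w' \<in> D z"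
  obtains m where "(m, q) \<in> R" "\<And>z. z \<in> Z \<Longrightarrow> m \<in> D z"
proof -
  obtain a g where a: "a \<in> Field r" and g: "inj_on g Z" "g ` Z \<subseteq> underS r a"
    using ordLess_imp_inj_underS[OF Z] .
  have step: "\<exists>w. (w, u) \<in> R \<and> (\<forall>z\<in>Z. g z = b \<longrightarrow> w \<in> D z)" if uq: "(u, q) \<in> R" for b u
  proof (cases "b \<in> g ` Z")
    case True
    then obtain z where z: "z \<in> Z" "b = g z" by blast
    then obtain w where w: "w \<in> D z" "(w, u) \<in> R"
      using dense uq by blast
    have "w \<in> D z'" if "z' \<in> Z" "g z' = b" for z'
      using inj_onD[OF g(1), of z' z] that z w by simp
    with w show ?thesis by blast
  next
    case False
    have "u \<in> Field R" using uq by (auto simp: Field_def)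
    then have "(u, u) \<in> R" by (rule refl)
    with False show ?thesis by blast
  qed
  obtain u w m where
    uw: "\<And>b. b \<in> underS r a \<Longrightarrow> (u b, q) \<in> R \<and> (w b, u b) \<in> R \<and> (\<forall>z\<in>Z. g z = b \<longrightarrow> w b \<in> D z)"
    and m: "(m, q) \<in> R" "\<And>b. b \<in> underS r a \<Longrightarrow> (m, w b) \<in> R"
    by (rule closed_chain[OF r cl tr refl a q, where St = "\<lambda>b u w. \<forall>z\<in>Z. g z = b \<longrightarrow> w \<in> D z"])
       (use step in blast)+
  show ?thesis
  proof (rule that[OF m(1)])
    fix z assume "z \<in> Z"
    moreover from this have "g z \<in> underS r a" using g by blast
    ultimately show "m \<in> D z"
      using m(2) uw opn by blast
  qed
qed

text \<open>
  Sequences indexed by initial segments of the shorter order \<open>r\<close> are copied to \<open>r'\<close> along an embedding,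
  which maps initial segments onto initial segments.
\<close>

lemma closed_forcing_mono:
  assumes cl: "closed_forcing r' R" and le: "r \<le>o r'"
  shows "closed_forcing r R"
  unfolding closed_forcing_def
proof (intro ballI allI impI)
  fix a s assume a: "a \<in> Field r" and s: "decreasing_seq R r a s"
  obtain f where wo: "Well_order r" "Well_order r'" and f: "embed r r' f"
    using le by (auto simp: ordLeq_def)
  have bij: "bij_betw f (underS r a) (underS r' (f a))"
    by (rule embed_underS[OF wo(1) f a])
  have inj: "inj_on f (Field r)"
    by (rule embed_inj_on[OF wo(1) f])
  have tot: "Total r" and anti: "antisym r'" and refl: "Refl r"
    using wo by (auto simp: well_order_on_def linear_order_on_def partial_order_on_def preorder_on_def)
  let ?g = "inv_into (underS r a) f"
  have fg: "f (?g b) = b" and g: "?g b \<in> underS r a" if "b \<in> underS r' (f a)" for b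
    using bij that by (auto simp: bij_betw_def f_inv_into_f inv_into_into)
  have order: "(b, c) \<in> r" if "(f b, f c) \<in> r'" "b \<in> Field r" "c \<in> Field r" for b c
  proof (rule ccontr)
    assume *: "(b, c) \<notin> r"
    then have "b \<noteq> c" using refl that by (auto simp: refl_on_def)
    then have "(c, b) \<in> r"
      using tot that * by (auto simp: total_on_def)
    then have "(f c, f b) \<in> r'"
      using embed_compat[OF f] by (auto simp: compat_def)
    then have "f b = f c" using that anti by (auto dest: antisymD)
    then show False
      using inj that \<open>b \<noteq> c\<close> by (auto dest: inj_onD)
  qed
  have F: "b \<in> Field r" if "b \<in> underS r a" for b
    using that by (auto simp: underS_def Field_def)
  have "decreasing_seq R r' (f a) (s \<circ> ?g)"
    unfolding decreasing_seq_def
  proof (intro conjI ballI impI)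
    fix b assume b: "b \<in> underS r' (f a)"
    show "(s \<circ> ?g) b \<in> Field R"
      using s g[OF b] by (simp add: decreasing_seq_def)
    fix c assume c: "c \<in> underS r' (f a)" and "(b, c) \<in> r'"
    then have "(?g b, ?g c) \<in> r"
      by (intro order) (simp_all add: fg b c F[OF g])
    then show "((s \<circ> ?g) c, (s \<circ> ?g) b) \<in> R"
      using s g[OF b] g[OF c] by (simp add: decreasing_seq_def)
  qed
  then obtain m where m: "is_lower_bound R ((s \<circ> ?g) ` underS r' (f a)) m"
    using cl embed_in_Field[OF f a] unfolding closed_forcing_def by blast
  have "(s \<circ> ?g) ` underS r' (f a) = s ` underS r a"
  proof -
    have "?g ` underS r' (f a) = underS r a"
      using bij_betw_inv_into[OF bij] by (rule bij_betw_imp_surj_on)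
    then show ?thesis by (metis image_comp)
  qed
  with m show "\<exists>m. is_lower_bound R (s ` underS r a) m" by auto
qed


section \<open>The product modulo finite changes\<close>

text \<open>
  Here \<open>K\<close> stands for the singular cardinal \<open>\<kappa>\<close> and \<open>C\<close> for the filtration of
  \<open>strong_limit_filtration\<close>.
\<close>

locale product =
  fixes P :: "nat \<Rightarrow> 'p rel" and \<kappa>s :: "nat \<Rightarrow> 'a rel" and K :: "'a set" and C :: "nat \<Rightarrow> 'a set"
  assumes forcing: "\<And>n. forcing_notion (P n)"
    and nontriv: "\<And>n. nontrivial (P n)"
    and separative: "\<And>n. separative (P n)"
    and closed: "\<And>n. closed_forcing (\<kappa>s n) (P n)"
    and \<kappa>s_mono: "\<And>m n. m \<le> n \<Longrightarrow> \<kappa>s m \<le>o \<kappa>s n"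
    and infinite_K: "infinite K"
    and C_mono: "\<And>m n. m \<le> n \<Longrightarrow> C m \<subseteq> C n"
    and C_Un: "(\<Union>n. C n) = K"
    and C_less: "\<And>n. |Pow (C n)| <o \<kappa>s n"
    and \<kappa>s_le_K: "\<And>n. \<kappa>s n \<le>o |K|"
begin

lemma P_refl: "p \<in> Field (P n) \<Longrightarrow> (p, p) \<in> P n"
  using forcing[of n]
  by (auto simp: forcing_notion_def partial_order_on_def preorder_on_def refl_on_def)

lemma P_trans: "(r, q) \<in> P n \<Longrightarrow> (q, p) \<in> P n \<Longrightarrow> (r, p) \<in> P n"
  using forcing[of n]
  by (auto simp: forcing_notion_def partial_order_on_def preorder_on_def dest: transD)

lemma P_Field: "(q, p) \<in> P n \<Longrightarrow> q \<in> Field (P n)" "(q, p) \<in> P n \<Longrightarrow> p \<in> Field (P n)"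
  by (auto simp: Field_def)

lemma wo_\<kappa>s: "Well_order (\<kappa>s n)"
  using \<kappa>s_mono[of n n] by (simp add: ordLeq_def)

definition Conds :: "(nat \<Rightarrow> 'p) set" where
  "Conds = {p. \<forall>n. p n \<in> Field (P n)}"

definition tail :: "nat \<Rightarrow> (nat \<Rightarrow> 'p) rel" where
  "tail N = {(q, p). q \<in> Conds \<and> p \<in> Conds \<and> (\<forall>k\<ge>N. (q k, p k) \<in> P k)}"

definition almost :: "(nat \<Rightarrow> 'p) \<Rightarrow> (nat \<Rightarrow> 'p) \<Rightarrow> bool" (infix "\<preceq>\<^sup>*" 50) where
  "q \<preceq>\<^sup>* p \<longleftrightarrow> (\<exists>N. (q, p) \<in> tail N)"

definition perp :: "(nat \<Rightarrow> 'p) \<Rightarrow> (nat \<Rightarrow> 'p) \<Rightarrow> bool" where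
  "perp p q \<longleftrightarrow> \<not> (\<exists>u. u \<preceq>\<^sup>* p \<and> u \<preceq>\<^sup>* q)"

lemma tail_refl: "p \<in> Conds \<Longrightarrow> (p, p) \<in> tail N"
  by (auto simp: tail_def Conds_def P_refl)

lemma tail_trans: "(r, q) \<in> tail M \<Longrightarrow> (q, p) \<in> tail N \<Longrightarrow> (r, p) \<in> tail (max M N)"
  using P_trans by (fastforce simp: tail_def)

lemma trans_tail: "trans (tail N)"
  using tail_trans[of _ _ N _ N] by (auto intro: transI)

lemma Field_tail: "Field (tail N) = Conds"
  using tail_refl[of _ N] by (auto simp: Field_def tail_def)

lemma tail_imp_almost: "(q, p) \<in> tail N \<Longrightarrow> q \<preceq>\<^sup>* p"
  by (auto simp: almost_def)

lemma almost_refl: "p \<in> Conds \<Longrightarrow> p \<preceq>\<^sup>* p"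
  using tail_refl tail_imp_almost by blast

lemma almost_trans: "r \<preceq>\<^sup>* q \<Longrightarrow> q \<preceq>\<^sup>* p \<Longrightarrow> r \<preceq>\<^sup>* p"
  unfolding almost_def using tail_trans by blast

lemma almost_Conds: "q \<preceq>\<^sup>* p \<Longrightarrow> q \<in> Conds" "q \<preceq>\<^sup>* p \<Longrightarrow> p \<in> Conds"
  by (auto simp: almost_def tail_def)

text \<open>
  Replacing finitely many coordinates of \<open>q\<close> by those of \<open>p\<close> turns an almost stronger condition into
  a stronger one. By this lemma a property that is invariant under finite changes can be arranged in any
  of the orders \<open>tail N\<close>, and in the product itself, which is \<open>tail 0\<close>.
\<close>

lemma almost_modify:
  assumes "q \<preceq>\<^sup>* p"
  obtains q' where "(q', p) \<in> tail 0" "q' \<preceq>\<^sup>* q" "q \<preceq>\<^sup>* q'"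
proof -
  obtain N where N: "(q, p) \<in> tail N"
    using assms by (auto simp: almost_def)
  let ?q = "\<lambda>k. if k < N then p k else q k"
  have q: "?q \<in> Conds" and "(?q, p) \<in> tail 0"
    using N by (auto simp: tail_def Conds_def P_refl)
  moreover have "(?q, q) \<in> tail N" "(q, ?q) \<in> tail N"
    using q N by (auto simp: tail_def Conds_def P_refl)
  ultimately show ?thesis
    using that tail_imp_almost by blast
qed

lemma tail_mono: "(q, p) \<in> tail M \<Longrightarrow> M \<le> N \<Longrightarrow> (q, p) \<in> tail N"
  by (auto simp: tail_def)

text \<open>
  From coordinate \<open>N\<close> on all factors are \<open>\<kappa>s N\<close>-closed, and lower bounds can be taken in each coordinate
  separately.
\<close>

lemma closed_tail: "closed_forcing (\<kappa>s N) (tail N)"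
  unfolding closed_forcing_def
proof (intro ballI allI impI)
  fix a s assume a: "a \<in> Field (\<kappa>s N)" and s: "decreasing_seq (tail N) (\<kappa>s N) a s"
  have "\<exists>m. is_lower_bound (P k) ((\<lambda>b. s b k) ` underS (\<kappa>s N) a) m" if k: "k \<ge> N" for k
  proof -
    have "decreasing_seq (P k) (\<kappa>s N) a (\<lambda>b. s b k)"
      using s k unfolding decreasing_seq_def Field_tail by (auto simp: tail_def Conds_def)
    then show ?thesis
      using closed_forcing_mono[OF closed \<kappa>s_mono[OF k]] a unfolding closed_forcing_def by blast
  qed
  then obtain m where m: "\<And>k. k \<ge> N \<Longrightarrow> is_lower_bound (P k) ((\<lambda>b. s b k) ` underS (\<kappa>s N) a) (m k)"
    by metis
  obtain t where t: "\<And>k. t k \<in> Field (P k)"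
    using forcing unfolding forcing_notion_def is_top_def by metis
  let ?m = "\<lambda>k. if k < N then t k else m k"
  have "?m \<in> Conds"
    using m t by (auto simp: Conds_def is_lower_bound_def)
  moreover have "(?m, s b) \<in> tail N" if "b \<in> underS (\<kappa>s N) a" for b
    using \<open>?m \<in> Conds\<close> m that s unfolding decreasing_seq_def Field_tail
    by (auto simp: tail_def is_lower_bound_def)
  ultimately show "\<exists>m. is_lower_bound (tail N) (s ` underS (\<kappa>s N) a) m"
    by (intro exI[of _ ?m]) (auto simp: is_lower_bound_def Field_tail)
qed

text \<open>
  At the coordinate \<open>k\<close> only the first \<open>k\<close> steps of the descent are guaranteed to be decreasing, and
  the diagonal uses exactly these.
\<close>

lemma diagonal_lower_bound:
  assumes g: "\<And>n. (g (Suc n), g n) \<in> tail n"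
  shows "((\<lambda>k. g k k), g n) \<in> tail n"
proof -
  have gC: "g n \<in> Conds" for n
    using g[of n] by (auto simp: tail_def)
  have "(g (n + d) k, g n k) \<in> P k" if "k \<ge> n + d" for n d k
    using that
  proof (induction d)
    case 0
    then show ?case using gC by (simp add: Conds_def P_refl)
  next
    case (Suc d)
    then have "(g (Suc (n + d)) k, g (n + d) k) \<in> P k"
      using g[of "n + d"] by (simp add: tail_def)
    then show ?case using Suc P_trans by simp
  qed
  from this[of n "k - n" k for k] show ?thesis
    using gC by (auto simp: tail_def Conds_def)
qed

lemma perp_sym: "perp p q \<Longrightarrow> perp q p"
  by (auto simp: perp_def)

lemma perpI:
  assumes "\<And>N. \<exists>n\<ge>N. \<not> compatible (P n) (p n) (q n)"
  shows "perp p q"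
  unfolding perp_def
proof
  assume "\<exists>u. u \<preceq>\<^sup>* p \<and> u \<preceq>\<^sup>* q"
  then obtain u M N where "(u, p) \<in> tail M" "(u, q) \<in> tail N"
    by (auto simp: almost_def)
  then have "compatible (P n) (p n) (q n)" if "n \<ge> max M N" for n
    using that by (auto simp: tail_def compatible_def)
  then show False
    using assms by blast
qed

text \<open>
  If \<open>q\<close> is not almost stronger than \<open>p\<close>, separativity of \<open>P n\<close> applies at infinitely many \<open>n\<close>, and
  conditions that are incompatible in infinitely many coordinates stay incompatible modulo finite changes.
\<close>

lemma almost_separative:
  assumes "p \<in> Conds" "q \<in> Conds" "\<not> q \<preceq>\<^sup>* p"
  obtains u where "u \<preceq>\<^sup>* q" "perp u p"
proof -
  have "\<exists>x. (x, q n) \<in> P n \<and> ((q n, p n) \<notin> P n \<longrightarrow> \<not> compatible (P n) x (p n))" for n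
  proof (cases "(q n, p n) \<in> P n")
    case True
    then show ?thesis using P_refl P_Field by blast
  next
    case False
    then show ?thesis
      using separative[of n] assms by (auto simp: separative_def Conds_def)
  qed
  then obtain u where u: "\<And>n. (u n, q n) \<in> P n"
      "\<And>n. (q n, p n) \<notin> P n \<Longrightarrow> \<not> compatible (P n) (u n) (p n)"
    by metis
  have uC: "u \<in> Conds" using u(1) P_Field by (auto simp: Conds_def)
  have "(u, q) \<in> tail 0"
    using u uC assms by (auto simp: tail_def)
  moreover have "perp u p"
  proof (rule perpI)
    fix N
    have "(q, p) \<notin> tail N" using assms by (auto simp: almost_def)
    then show "\<exists>n\<ge>N. \<not> compatible (P n) (u n) (p n)"
      using u(2) assms by (auto simp: tail_def)
  qed
  ultimately show ?thesis
    using that tail_imp_almost by blast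
qed

text \<open>
  In coordinate \<open>n\<close> the trace \<open>X \<inter> C n\<close> selects a member of an antichain of \<open>P n\<close> below \<open>p n\<close>. Since
  the sets \<open>C n\<close> increase to \<open>K\<close>, the traces of two different sets differ for all large \<open>n\<close>.
\<close>

lemma large_antichain:
  assumes p: "p \<in> Conds"
  obtains f where "\<And>X. X \<subseteq> K \<Longrightarrow> f X \<preceq>\<^sup>* p"
    "\<And>X Y. X \<subseteq> K \<Longrightarrow> Y \<subseteq> K \<Longrightarrow> X \<noteq> Y \<Longrightarrow> perp (f X) (f Y)"
proof -
  have "\<exists>c. (\<forall>z\<in>Pow (C n). (c z, p n) \<in> P n) \<and>
      (\<forall>z\<in>Pow (C n). \<forall>z'\<in>Pow (C n). z \<noteq> z' \<longrightarrow> \<not> compatible (P n) (c z) (c z'))" for n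
  proof (rule closed_splitting_family[where R = "P n" and r = "\<kappa>s n" and Z = "Pow (C n)" and q = "p n"
        and Sep = "\<lambda>x y. \<not> compatible (P n) x y", OF wo_\<kappa>s closed _ P_refl _ C_less])
    show "trans (P n)" using P_trans by (rule transI)
    show "p n \<in> Field (P n)" using p by (simp add: Conds_def)
    show "\<exists>w s. (w, u) \<in> P n \<and> (s, u) \<in> P n \<and> \<not> compatible (P n) w s" if "(u, p n) \<in> P n" for u
      using nontriv[of n] P_Field(1)[OF that] by (auto simp: nontrivial_def)
    show "\<not> compatible (P n) s w" if "\<not> compatible (P n) w s" for w s
      using that by (auto simp: compatible_def)
    show "\<not> compatible (P n) w' s" if "\<not> compatible (P n) w s" "(w', w) \<in> P n" for w w' s
      using that P_trans by (auto simp: compatible_def)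
  qed blast+
  then obtain c where c: "\<And>n z. z \<subseteq> C n \<Longrightarrow> (c n z, p n) \<in> P n"
    "\<And>n z z'. z \<subseteq> C n \<Longrightarrow> z' \<subseteq> C n \<Longrightarrow> z \<noteq> z' \<Longrightarrow> \<not> compatible (P n) (c n z) (c n z')"
    unfolding Ball_def Pow_iff by metis
  let ?f = "\<lambda>X n. c n (X \<inter> C n)"
  have fC: "?f X \<in> Conds" for X
    using P_Field(1)[OF c(1)] by (auto simp: Conds_def)
  show ?thesis
  proof (rule that[of ?f])
    show "?f X \<preceq>\<^sup>* p" for X
      using fC c(1) p by (intro tail_imp_almost[of _ _ 0]) (auto simp: tail_def)
    fix X Y assume XY: "X \<subseteq> K" "Y \<subseteq> K" "X \<noteq> Y"
    then obtain x where "x \<in> K" "x \<in> X \<longleftrightarrow> x \<notin> Y" by blast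
    then obtain m where m: "x \<in> C m" using C_Un by blast
    show "perp (?f X) (?f Y)"
    proof (rule perpI)
      fix N
      have "X \<inter> C (max m N) \<noteq> Y \<inter> C (max m N)"
        using m C_mono[of m "max m N"] \<open>x \<in> X \<longleftrightarrow> x \<notin> Y\<close> by auto
      then show "\<exists>n\<ge>N. \<not> compatible (P n) (?f X n) (?f Y n)"
        using c(2) by (intro exI[of _ "max m N"]) auto
    qed
  qed
qed

definition dense_open :: "(nat \<Rightarrow> 'p) set \<Rightarrow> bool" where
  "dense_open E \<longleftrightarrow> E \<subseteq> Conds \<and> (\<forall>p\<in>Conds. \<exists>w\<in>E. w \<preceq>\<^sup>* p) \<and> (\<forall>p\<in>E. \<forall>q. q \<preceq>\<^sup>* p \<longrightarrow> q \<in> E)"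

text \<open>
  Distribute the dense sets over the filtration: the fewer than \<open>\<kappa>s n\<close> sets with index in \<open>C n\<close> are met by
  a descent in the closed order \<open>tail n\<close>. Doing this for \<open>n = 0, 1, \<dots>\<close> gives a sequence whose diagonal is
  almost stronger than all of its terms.
\<close>

lemma distributive:
  assumes J: "|J| \<le>o |K|" and E: "\<And>i. i \<in> J \<Longrightarrow> dense_open (E i)" and p: "p \<in> Conds"
  obtains m where "m \<preceq>\<^sup>* p" "\<And>i. i \<in> J \<Longrightarrow> m \<in> E i"
proof -
  obtain h where h: "inj_on h J" "h ` J \<subseteq> K"
    using J unfolding card_of_ordLeq[symmetric] by blast
  define J' where "J' n = {i \<in> J. h i \<in> C n}" for n
  have J'_less: "|J' n| <o \<kappa>s n" for n
  proof -
    have "inj_on h (J' n)" "h ` J' n \<subseteq> C n"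
      using h by (auto simp: J'_def intro: inj_on_subset)
    then have "|J' n| \<le>o |C n|" unfolding card_of_ordLeq[symmetric] by blast
    then show ?thesis
      by (rule ordLeq_ordLess_trans[OF _ ordLess_transitive[OF card_of_Pow C_less]])
  qed
  have "\<exists>m. (m, q) \<in> tail n \<and> (\<forall>i\<in>J' n. m \<in> E i)" if q: "q \<in> Conds" for n q
  proof (rule closed_distributive[where R = "tail n" and q = q and D = E,
        OF wo_\<kappa>s closed_tail trans_tail _ _ J'_less])
    show "(p, p) \<in> tail n" if "p \<in> Field (tail n)" for p
      using that by (simp add: Field_tail tail_refl)
    show "q \<in> Field (tail n)" using q by (simp add: Field_tail)
    show "\<exists>w\<in>E i. (w, u) \<in> tail n" if "i \<in> J' n" "(u, q) \<in> tail n" for i u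
    proof -
      have i: "dense_open (E i)" using E that by (simp add: J'_def)
      moreover have "u \<in> Conds" using that by (simp add: tail_def)
      ultimately obtain w where w: "w \<in> E i" "w \<preceq>\<^sup>* u"
        by (auto simp: dense_open_def)
      obtain w' where "(w', u) \<in> tail 0" "w' \<preceq>\<^sup>* w"
        using almost_modify[OF w(2)] by blast
      then show ?thesis
        using i w(1) tail_mono[of w' u 0 n] by (auto simp: dense_open_def)
    qed
    show "w' \<in> E i" if "i \<in> J' n" "w \<in> E i" "(w', w) \<in> tail n" for i w w'
      using E that tail_imp_almost by (auto simp: J'_def dense_open_def)
  qed blast
  then have "\<forall>n q. \<exists>m. q \<in> Conds \<longrightarrow> (m, q) \<in> tail n \<and> (\<forall>i\<in>J' n. m \<in> E i)"
    by blast
  then obtain S where "\<forall>n q. q \<in> Conds \<longrightarrow> (S n q, q) \<in> tail n \<and> (\<forall>i\<in>J' n. S n q \<in> E i)"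
    by (auto simp only: choice_iff)
  then have S: "\<And>n q. q \<in> Conds \<Longrightarrow> (S n q, q) \<in> tail n"
      "\<And>n q i. q \<in> Conds \<Longrightarrow> i \<in> J' n \<Longrightarrow> S n q \<in> E i"
    by blast+
  define g where "g = rec_nat p S"
  have g0: "g 0 = p" and gS: "g (Suc n) = S n (g n)" for n
    by (simp_all add: g_def)
  have gC: "g n \<in> Conds" for n
    by (induction n) (use p S(1) in \<open>auto simp: g0 gS tail_def\<close>)
  have g_dec: "(g (Suc n), g n) \<in> tail n" for n
    using S(1)[OF gC] by (simp add: gS)
  note below = diagonal_lower_bound[of g, OF g_dec]
  show ?thesis
  proof (rule that[of "\<lambda>k. g k k"])
    show "(\<lambda>k. g k k) \<preceq>\<^sup>* p"
      using tail_imp_almost[OF below[of 0]] by (simp add: g0)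
    fix i assume i: "i \<in> J"
    then obtain n where n: "i \<in> J' n"
      using h C_Un by (auto simp: J'_def)
    have "g (Suc n) \<in> E i"
      using S(2)[OF gC n] by (simp add: gS)
    then show "(\<lambda>k. g k k) \<in> E i"
      using E[OF i] tail_imp_almost[OF below[of "Suc n"]] by (auto simp: dense_open_def)
  qed
qed

text \<open>
  \<open>p\<close> and \<open>q\<close> decide differently which member of the antichain \<open>A\<close> belongs to the generic filter.
\<close>

definition separates :: "(nat \<Rightarrow> 'p) set \<Rightarrow> (nat \<Rightarrow> 'p) \<Rightarrow> (nat \<Rightarrow> 'p) \<Rightarrow> bool" where
  "separates A p q \<longleftrightarrow> (\<exists>a\<in>A. \<exists>b\<in>A. a \<noteq> b \<and> p \<preceq>\<^sup>* a \<and> q \<preceq>\<^sup>* b)"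

lemma separatesI:
  "a \<in> A \<Longrightarrow> b \<in> A \<Longrightarrow> a \<noteq> b \<Longrightarrow> p \<preceq>\<^sup>* a \<Longrightarrow> q \<preceq>\<^sup>* b \<Longrightarrow> separates A p q"
  unfolding separates_def by blast

lemma separatesE:
  assumes "separates A p q"
  obtains a b where "a \<in> A" "b \<in> A" "a \<noteq> b" "p \<preceq>\<^sup>* a" "q \<preceq>\<^sup>* b"
  using assms unfolding separates_def by blast

lemma separates_sym: "separates A p q \<Longrightarrow> separates A q p"
  by (erule separatesE) (rule separatesI[OF _ _ not_sym])

lemma separates_below:
  assumes "separates A p q" "p' \<preceq>\<^sup>* p" "q' \<preceq>\<^sup>* q"
  shows "separates A p' q'"
  using assms(1)
  by (rule separatesE) (erule (2) separatesI, (erule almost_trans[OF assms(2)] almost_trans[OF assms(3)])+)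

text \<open>
  The two separated extensions of a condition may have to be changed at finitely many places to become
  extensions in the closed order \<open>tail n\<close>, where the splitting is then iterated.
\<close>

lemma split_many:
  assumes q: "q \<in> Conds"
    and split: "\<And>u. u \<in> Conds \<Longrightarrow> \<exists>i\<in>I. \<exists>w s. w \<preceq>\<^sup>* u \<and> s \<preceq>\<^sup>* u \<and> separates (A i) w s"
  obtains f where "\<And>z. z \<subseteq> C n \<Longrightarrow> (f z, q) \<in> tail n"
    "\<And>z z'. z \<subseteq> C n \<Longrightarrow> z' \<subseteq> C n \<Longrightarrow> z \<noteq> z' \<Longrightarrow> \<exists>i\<in>I. separates (A i) (f z) (f z')"
proof (rule closed_splitting_family[where R = "tail n" and q = q and
      Sep = "\<lambda>w s. \<exists>i\<in>I. separates (A i) w s", OF wo_\<kappa>s closed_tail trans_tail _ _ C_less])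
  show "(p, p) \<in> tail n" if "p \<in> Field (tail n)" for p
    using that by (simp add: Field_tail tail_refl)
  show "q \<in> Field (tail n)" using q by (simp add: Field_tail)
  show "\<exists>w s. (w, u) \<in> tail n \<and> (s, u) \<in> tail n \<and> (\<exists>i\<in>I. separates (A i) w s)"
    if "(u, q) \<in> tail n" for u
  proof -
    have "u \<in> Conds" using that by (simp add: tail_def)
    then obtain i w s where i: "i \<in> I" and w: "w \<preceq>\<^sup>* u" and s: "s \<preceq>\<^sup>* u" and sep: "separates (A i) w s"
      using split by blast
    obtain w' where w': "(w', u) \<in> tail 0" "w' \<preceq>\<^sup>* w"
      using almost_modify[OF w] by blast
    obtain s' where s': "(s', u) \<in> tail 0" "s' \<preceq>\<^sup>* s"
      using almost_modify[OF s] by blast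
    have "separates (A i) w' s'"
      by (rule separates_below[OF sep w'(2) s'(2)])
    then show ?thesis
      using i tail_mono[OF w'(1), of n] tail_mono[OF s'(1), of n] by blast
  qed
  show "\<exists>i\<in>I. separates (A i) s w" if "\<exists>i\<in>I. separates (A i) w s" for w s
    using that separates_sym by blast
  show "\<exists>i\<in>I. separates (A i) w' s" if "\<exists>i\<in>I. separates (A i) w s" "(w', w) \<in> tail n" for w w' s
  proof -
    from that(1) obtain i where i: "i \<in> I" "separates (A i) w s" by blast
    then have "s \<in> Conds" using almost_Conds by (auto simp: separates_def)
    then show ?thesis
      using separates_below[OF i(2) tail_imp_almost[OF that(2)] almost_refl] i(1) by blast
  qed
qed (use that in blast)

text \<open>
  Grow a tree of conditions of height \<open>\<omega>\<close>, splitting each condition of level \<open>n\<close> into pairwise separated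
  extensions indexed by the subsets of \<open>C n\<close>. A set \<open>X \<subseteq> K\<close> determines the branch which takes the direction
  \<open>X \<inter> C n\<close> at level \<open>n\<close>, and \<open>f X\<close> is the diagonal of this branch. There are \<open>2\<^sup>\<kappa>\<close> branches but only \<open>\<kappa>\<close>
  nodes, so \<open>\<kappa>\<close> many antichains suffice to separate the branches: two branches are separated where they
  part for the first time.
\<close>

lemma fusion:
  fixes A :: "'i \<Rightarrow> (nat \<Rightarrow> 'p) set"
  assumes q: "q \<in> Conds"
    and split: "\<And>u. u \<in> Conds \<Longrightarrow> \<exists>i\<in>I. \<exists>w s. w \<preceq>\<^sup>* u \<and> s \<preceq>\<^sup>* u \<and> separates (A i) w s"
  obtains J f where "J \<subseteq> I" "|J| \<le>o |K|" "\<And>X. X \<subseteq> K \<Longrightarrow> f X \<preceq>\<^sup>* q"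
    "\<And>X Y. X \<subseteq> K \<Longrightarrow> Y \<subseteq> K \<Longrightarrow> X \<noteq> Y \<Longrightarrow> \<exists>i\<in>J. separates (A i) (f X) (f Y)"
proof -
  have "\<forall>n u. \<exists>S. u \<in> Conds \<longrightarrow> (\<forall>z\<in>Pow (C n). (S z, u) \<in> tail n \<and>
      (\<forall>z'\<in>Pow (C n). z \<noteq> z' \<longrightarrow> (\<exists>i\<in>I. separates (A i) (S z) (S z'))))"
  proof (intro allI)
    fix n u
    show "\<exists>S. u \<in> Conds \<longrightarrow> (\<forall>z\<in>Pow (C n). (S z, u) \<in> tail n \<and>
      (\<forall>z'\<in>Pow (C n). z \<noteq> z' \<longrightarrow> (\<exists>i\<in>I. separates (A i) (S z) (S z'))))"
    proof (cases "u \<in> Conds")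
      case True
      show ?thesis
        by (rule split_many[OF True split, of n]) (assumption, blast)
    qed blast
  qed
  then obtain S where S': "\<forall>n u. u \<in> Conds \<longrightarrow> (\<forall>z\<in>Pow (C n). (S n u z, u) \<in> tail n \<and>
      (\<forall>z'\<in>Pow (C n). z \<noteq> z' \<longrightarrow> (\<exists>i\<in>I. separates (A i) (S n u z) (S n u z'))))"
    by (auto simp only: choice_iff)
  then have S: "\<And>n u z. u \<in> Conds \<Longrightarrow> z \<subseteq> C n \<Longrightarrow> (S n u z, u) \<in> tail n"
    by blast
  have "\<forall>n u z z'. \<exists>i. u \<in> Conds \<and> z \<subseteq> C n \<and> z' \<subseteq> C n \<and> z \<noteq> z' \<longrightarrow>
      i \<in> I \<and> separates (A i) (S n u z) (S n u z')"
    using S' unfolding Ball_def Pow_iff Bex_def by meson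
  then obtain ix where "\<forall>n u z z'. u \<in> Conds \<and> z \<subseteq> C n \<and> z' \<subseteq> C n \<and> z \<noteq> z' \<longrightarrow>
      ix n u z z' \<in> I \<and> separates (A (ix n u z z')) (S n u z) (S n u z')"
    by (auto simp only: choice_iff)
  then have ix: "\<And>n u z z'. u \<in> Conds \<Longrightarrow> z \<subseteq> C n \<Longrightarrow> z' \<subseteq> C n \<Longrightarrow> z \<noteq> z' \<Longrightarrow>
      ix n u z z' \<in> I \<and> separates (A (ix n u z z')) (S n u z) (S n u z')"
    by blast
  define g where "g X = rec_nat q (\<lambda>n u. S n u (X \<inter> C n))" for X
  have g0: "g X 0 = q" and gS: "g X (Suc n) = S n (g X n) (X \<inter> C n)" for X n
    by (simp_all add: g_def)
  have gC: "g X n \<in> Conds" for X n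
  proof (induction n)
    case (Suc n)
    then show ?case using S[of "g X n" "X \<inter> C n" n] by (simp add: gS tail_def)
  qed (simp add: g0 q)
  have g_dec: "(g X (Suc n), g X n) \<in> tail n" for X n
    using S[OF gC] by (simp add: gS)
  have g_cong: "g X n = g Y n" if "\<And>m. m < n \<Longrightarrow> X \<inter> C m = Y \<inter> C m" for X Y n
    using that by (induction n) (simp_all add: g0 gS)
  \<comment> \<open>The sets \<open>C m\<close> increase, so level \<open>n\<close> of the tree has at most one node for each subset of \<open>C n\<close>.\<close>
  have g_restrict: "g X n = g (X \<inter> C n) n" for X n
    by (rule g_cong) (use C_mono less_imp_le in blast)
  define f where "f X = (\<lambda>k. g X k k)" for X
  have f_below: "(f X, g X n) \<in> tail n" for X n
    unfolding f_def by (rule diagonal_lower_bound[OF g_dec])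
  define T where "T n = Pow (C n) \<times> (Pow (C n) \<times> Pow (C n))" for n
  define J where "J = (\<Union>n. (\<lambda>(y, z, z'). ix n (g y n) z z') ` {(y, z, z') \<in> T n. z \<noteq> z'})"
  show ?thesis
  proof (rule that[of J f])
    show "J \<subseteq> I"
    proof
      fix i assume "i \<in> J"
      then obtain n y z z' where z: "z \<subseteq> C n" "z' \<subseteq> C n" "z \<noteq> z'" and i: "i = ix n (g y n) z z'"
        unfolding J_def T_def by auto
      show "i \<in> I"
        unfolding i using ix[OF gC z] by blast
    qed
    have PowC: "|Pow (C n)| \<le>o |K|" for n
      using ordLess_imp_ordLeq[OF ordLess_ordLeq_trans[OF C_less \<kappa>s_le_K]] .
    have "|T n| \<le>o |K|" for n
      unfolding T_def
      by (intro card_of_Times_ordLeq_infinite_Field[of "|K|"] PowC)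
        (simp_all add: Field_card_of infinite_K card_of_card_order_on)
    moreover have "|(\<lambda>(y, z, z'). ix n (g y n) z z') ` {(y, z, z') \<in> T n. z \<noteq> z'}| \<le>o |T n|" for n
      by (rule ordLeq_transitive[OF card_of_image card_of_mono1]) blast
    ultimately have "|(\<lambda>(y, z, z'). ix n (g y n) z z') ` {(y, z, z') \<in> T n. z \<noteq> z'}| \<le>o |K|" for n
      using ordLeq_transitive by blast
    then show "|J| \<le>o |K|"
      unfolding J_def using infinite_K
      by (intro card_of_UNION_ordLeq_infinite ballI) (simp_all add: infinite_iff_card_of_nat)
    show "f X \<preceq>\<^sup>* q" for X
      using tail_imp_almost[OF f_below[of X 0]] by (simp add: g0)
    fix X Y assume XY: "X \<subseteq> K" "Y \<subseteq> K" "X \<noteq> Y"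
    then obtain x where "x \<in> K" "x \<in> X \<longleftrightarrow> x \<notin> Y" by blast
    then obtain m where "x \<in> C m" using C_Un by blast
    then have ex: "\<exists>m. X \<inter> C m \<noteq> Y \<inter> C m"
      using \<open>x \<in> X \<longleftrightarrow> x \<notin> Y\<close> by blast
    define n where "n = (LEAST m. X \<inter> C m \<noteq> Y \<inter> C m)"
    have n: "X \<inter> C n \<noteq> Y \<inter> C n"
      unfolding n_def by (rule LeastI_ex[OF ex])
    have "g X n = g Y n"
      by (rule g_cong) (use not_less_Least in \<open>auto simp: n_def\<close>)
    let ?u = "g (X \<inter> C n) n"
    let ?i = "ix n ?u (X \<inter> C n) (Y \<inter> C n)"
    have "(X \<inter> C n, X \<inter> C n, Y \<inter> C n) \<in> {(y, z, z') \<in> T n. z \<noteq> z'}"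
      using n by (simp add: T_def)
    then have "?i \<in> J"
      unfolding J_def by force
    moreover have "separates (A ?i) (g X (Suc n)) (g Y (Suc n))"
      using ix[OF gC _ _ n] \<open>g X n = g Y n\<close> g_restrict[of X n] by (simp add: gS)
    then have "separates (A ?i) (f X) (f Y)"
      by (rule separates_below) (rule tail_imp_almost[OF f_below])+
    ultimately show "\<exists>i\<in>J. separates (A i) (f X) (f Y)" by blast
  qed
qed

end

section \<open>Splitting antichains and labels\<close>

text \<open>
  By Zorn's lemma. In the application \<open>D\<close> is dense, so that \<open>A\<close> is a maximal antichain of the whole order.
\<close>

lemma maximal_incompatible_family:
  assumes "\<And>x. x \<in> D \<Longrightarrow> \<not> perp x x" and sym: "\<And>x y. perp x y \<Longrightarrow> perp y x"
  obtains A where "A \<subseteq> D" "\<And>a b. a \<in> A \<Longrightarrow> b \<in> A \<Longrightarrow> a \<noteq> b \<Longrightarrow> perp a b"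
    "\<And>d. d \<in> D \<Longrightarrow> \<exists>a\<in>A. \<not> perp d a"
proof -
  let ?F = "{A. A \<subseteq> D \<and> (\<forall>a\<in>A. \<forall>b\<in>A. a \<noteq> b \<longrightarrow> perp a b)}"
  have "\<exists>M\<in>?F. \<forall>X\<in>?F. M \<subseteq> X \<longrightarrow> X = M"
  proof (rule subset_Zorn')
    fix \<C> assume "subset.chain ?F \<C>"
    then have sub: "\<C> \<subseteq> ?F" and chain: "\<And>X Y. X \<in> \<C> \<Longrightarrow> Y \<in> \<C> \<Longrightarrow> X \<subseteq> Y \<or> Y \<subseteq> X"
      by (auto simp: subset_chain_def)
    have "perp a b" if ab: "a \<in> \<Union>\<C>" "b \<in> \<Union>\<C>" "a \<noteq> b" for a b
    proof -
      obtain X Y where X: "X \<in> \<C>" "a \<in> X" and Y: "Y \<in> \<C>" "b \<in> Y"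
        using ab by blast
      then obtain Z where "Z \<in> \<C>" "a \<in> Z" "b \<in> Z"
        using chain[of X Y] by blast
      moreover have "Z \<in> ?F" using sub \<open>Z \<in> \<C>\<close> by (rule subsetD)
      ultimately show ?thesis
        using ab(3) by simp
    qed
    moreover have "X \<subseteq> D" if "X \<in> \<C>" for X
      using subsetD[OF sub that] by simp
    then have "\<Union>\<C> \<subseteq> D" by (rule Union_least)
    ultimately show "\<Union>\<C> \<in> ?F" by simp
  qed
  then obtain M where M: "M \<in> ?F" and max: "\<forall>X\<in>?F. M \<subseteq> X \<longrightarrow> X = M"
    by (rule bexE)
  show ?thesis
  proof (rule that[of M])
    fix d assume d: "d \<in> D"
    show "\<exists>a\<in>M. \<not> perp d a"
    proof (rule ccontr)
      assume "\<not> (\<exists>a\<in>M. \<not> perp d a)"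
      then have all: "\<And>a. a \<in> M \<Longrightarrow> perp d a" by blast
      then have "insert d M \<in> ?F"
        using M d sym by auto
      then have "insert d M = M" by (rule max[THEN bspec, THEN mp]) blast
      then have "perp d d" using all by blast
      then show False using assms(1)[OF d] by blast
    qed
  qed (use M in blast)+
qed

context product
begin

lemma not_perp_self: "p \<in> Conds \<Longrightarrow> \<not> perp p p"
  using almost_refl by (auto simp: perp_def)

text \<open>
  The conditions \<open>D\<close> above no member of \<open>Q\<close> are dense: of the \<open>2\<^sup>\<kappa>\<close> incompatible conditions below \<open>p\<close>,
  each member of \<open>Q\<close> lies below at most one, so one of them lies above none. Let \<open>A\<close> be a
  maximal antichain of such conditions. A condition \<open>q \<in> Q\<close> meets some \<open>a \<in> A\<close>; as \<open>q\<close> is not almost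
  stronger than \<open>a\<close>, separativity gives an extension of \<open>q\<close> incompatible with \<open>a\<close>, and this one meets another
  member of \<open>A\<close>.
\<close>

lemma splitting_antichain:
  assumes Q: "Q \<subseteq> Conds" "|Q| <o |Pow K|"
  obtains A where "A \<subseteq> Conds" "\<And>a b. a \<in> A \<Longrightarrow> b \<in> A \<Longrightarrow> a \<noteq> b \<Longrightarrow> perp a b"
    "dense_open {p. \<exists>a\<in>A. p \<preceq>\<^sup>* a}"
    "\<And>q. q \<in> Q \<Longrightarrow> \<exists>w s. w \<preceq>\<^sup>* q \<and> s \<preceq>\<^sup>* q \<and> separates A w s"
proof -
  define D where "D = {p \<in> Conds. \<forall>q\<in>Q. \<not> q \<preceq>\<^sup>* p}"
  have D_dense: "\<exists>d\<in>D. d \<preceq>\<^sup>* p" if p: "p \<in> Conds" for p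
  proof -
    obtain f where f: "\<And>X. X \<subseteq> K \<Longrightarrow> f X \<preceq>\<^sup>* p"
      "\<And>X Y. X \<subseteq> K \<Longrightarrow> Y \<subseteq> K \<Longrightarrow> X \<noteq> Y \<Longrightarrow> perp (f X) (f Y)"
      by (rule large_antichain[OF p]) blast
    define g where "g q = (SOME X. X \<subseteq> K \<and> q \<preceq>\<^sup>* f X)" for q
    have "|g ` Q| <o |Pow K|"
      by (rule ordLeq_ordLess_trans[OF card_of_image Q(2)])
    then have "\<not> Pow K \<subseteq> g ` Q"
      using card_of_mono1[of "Pow K" "g ` Q"] not_ordLess_ordLeq by blast
    then obtain X where X: "X \<subseteq> K" "X \<notin> g ` Q" by blast
    have "\<not> q \<preceq>\<^sup>* f X" if q: "q \<in> Q" for q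
    proof
      assume below: "q \<preceq>\<^sup>* f X"
      then have "g q \<subseteq> K \<and> q \<preceq>\<^sup>* f (g q)"
        unfolding g_def using X(1) by (intro someI[of "\<lambda>X. X \<subseteq> K \<and> q \<preceq>\<^sup>* f X" X]) blast
      moreover have "g q \<noteq> X" using X q by blast
      ultimately show False
        using f(2)[OF _ X(1)] below by (auto simp: perp_def)
    qed
    then show ?thesis
      using f(1)[OF X(1)] almost_Conds by (auto simp: D_def)
  qed
  obtain A where A: "A \<subseteq> D" and anti: "\<And>a b. a \<in> A \<Longrightarrow> b \<in> A \<Longrightarrow> a \<noteq> b \<Longrightarrow> perp a b"
    and max: "\<And>d. d \<in> D \<Longrightarrow> \<exists>a\<in>A. \<not> perp d a"
    by (rule maximal_incompatible_family[of D perp]) (auto simp: D_def not_perp_self perp_sym)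
  have refine: "\<exists>a\<in>A. \<exists>w. w \<preceq>\<^sup>* p \<and> w \<preceq>\<^sup>* a" if "p \<in> Conds" for p
  proof -
    obtain d where d: "d \<in> D" "d \<preceq>\<^sup>* p" using D_dense \<open>p \<in> Conds\<close> by blast
    obtain a w where "a \<in> A" "w \<preceq>\<^sup>* d" "w \<preceq>\<^sup>* a"
      using max[OF d(1)] by (auto simp: perp_def)
    then show ?thesis using almost_trans[OF _ d(2)] by blast
  qed
  show ?thesis
  proof (rule that[of A, OF _ anti])
    show "A \<subseteq> Conds" using A by (auto simp: D_def)
    show "dense_open {p. \<exists>a\<in>A. p \<preceq>\<^sup>* a}"
      unfolding dense_open_def
    proof (intro conjI ballI allI impI)
      show "{p. \<exists>a\<in>A. p \<preceq>\<^sup>* a} \<subseteq> Conds" using almost_Conds by blast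
      show "\<exists>w\<in>{p. \<exists>a\<in>A. p \<preceq>\<^sup>* a}. w \<preceq>\<^sup>* p" if "p \<in> Conds" for p
        using refine[OF that] by blast
      show "q \<in> {p. \<exists>a\<in>A. p \<preceq>\<^sup>* a}" if "p \<in> {p. \<exists>a\<in>A. p \<preceq>\<^sup>* a}" "q \<preceq>\<^sup>* p" for p q
        using that almost_trans by blast
    qed
    fix q assume q: "q \<in> Q"
    then have qC: "q \<in> Conds" using Q by blast
    obtain a w where a: "a \<in> A" and w: "w \<preceq>\<^sup>* q" "w \<preceq>\<^sup>* a"
      using refine[OF qC] by blast
    have aC: "a \<in> Conds" and "\<not> q \<preceq>\<^sup>* a"
      using a A q by (auto simp: D_def)
    then obtain u where u: "u \<preceq>\<^sup>* q" "perp u a"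
      using almost_separative[OF aC qC] by blast
    obtain b s where b: "b \<in> A" and s: "s \<preceq>\<^sup>* u" "s \<preceq>\<^sup>* b"
      using refine[OF almost_Conds(1)[OF u(1)]] by blast
    have "a \<noteq> b" using u(2) s by (auto simp: perp_def)
    then have "separates A w s" using a b w(2) s(2) by (intro separatesI)
    then show "\<exists>w s. w \<preceq>\<^sup>* q \<and> s \<preceq>\<^sup>* q \<and> separates A w s"
      using w(1) almost_trans[OF s(1) u(1)] by blast
  qed
qed

text \<open>
  \<open>D j\<close> consists of the conditions that decide for every \<open>i < j\<close> which member of the \<open>i\<close>-th antichain is
  generic, \<open>val j\<close> is the sequence of these decisions, and \<open>v j\<close> its label. By \<open>fusion\<close> each
  condition has \<open>2\<^sup>\<kappa>\<close> values below it at some \<open>j\<close>. There are only \<open>2\<^sup>\<kappa>\<close> pairs of a condition and a label, so for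
  each \<open>j\<close> every pair whose condition has \<open>2\<^sup>\<kappa>\<close> values at \<open>j\<close> can get a value of its own, below that
  condition, to which the label is attached.
\<close>

lemma collapsing_labels:
  fixes \<rho> :: "'i rel"
  assumes \<rho>: "Card_order \<rho>"
    and small: "\<And>j. j \<in> Field \<rho> \<Longrightarrow> |underS \<rho> j| \<le>o |K|"
    and bounded: "\<And>J. J \<subseteq> Field \<rho> \<Longrightarrow> |J| \<le>o |K| \<Longrightarrow> \<exists>j\<in>Field \<rho>. J \<subseteq> underS \<rho> j"
    and cof: "has_cofinality |Pow K| \<rho>"
    and card: "|Conds| \<le>o |Pow K|"
  obtains D v where "\<forall>j\<in>Field \<rho>. dense_open (D j)" "\<forall>j p. v j p \<subseteq> K"
    "\<forall>j\<in>Field \<rho>. \<forall>p\<in>D j. \<forall>q. q \<preceq>\<^sup>* p \<longrightarrow> v j q = v j p"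
    "\<forall>p\<in>Conds. \<forall>X\<in>Pow K. \<exists>j\<in>Field \<rho>. \<exists>d\<in>D j. d \<preceq>\<^sup>* p \<and> v j d = X"
proof -
  obtain Q where Q: "\<And>i. i \<in> Field \<rho> \<Longrightarrow> Q i \<subseteq> Conds" "\<And>i. i \<in> Field \<rho> \<Longrightarrow> |Q i| <o |Pow K|"
    and Q_Un: "Conds \<subseteq> (\<Union>i\<in>Field \<rho>. Q i)"
    by (rule cofinality_cover[OF cof \<rho> card], rule that) simp_all
  have "\<forall>i. \<exists>A. i \<in> Field \<rho> \<longrightarrow> (\<forall>a\<in>A. \<forall>b\<in>A. a \<noteq> b \<longrightarrow> perp a b) \<and> dense_open {p. \<exists>a\<in>A. p \<preceq>\<^sup>* a} \<and>
      (\<forall>q\<in>Q i. \<exists>w s. w \<preceq>\<^sup>* q \<and> s \<preceq>\<^sup>* q \<and> separates A w s)"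
  proof
    fix i
    show "\<exists>A. i \<in> Field \<rho> \<longrightarrow> (\<forall>a\<in>A. \<forall>b\<in>A. a \<noteq> b \<longrightarrow> perp a b) \<and> dense_open {p. \<exists>a\<in>A. p \<preceq>\<^sup>* a} \<and>
      (\<forall>q\<in>Q i. \<exists>w s. w \<preceq>\<^sup>* q \<and> s \<preceq>\<^sup>* q \<and> separates A w s)"
    proof (cases "i \<in> Field \<rho>")
      case True
      show ?thesis
      proof (rule splitting_antichain[OF Q[OF True]], rule exI, intro impI conjI ballI)
        fix A a b
        assume "\<And>a b. a \<in> A \<Longrightarrow> b \<in> A \<Longrightarrow> a \<noteq> b \<Longrightarrow> perp a b" "a \<in> A" "b \<in> A" "a \<noteq> b"
        then show "perp a b" by simp
      next
        fix A assume "dense_open {p. \<exists>a\<in>A. p \<preceq>\<^sup>* a}"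
        then show "dense_open {p. \<exists>a\<in>A. p \<preceq>\<^sup>* a}" .
      next
        fix A q
        assume "\<And>q. q \<in> Q i \<Longrightarrow> \<exists>w s. w \<preceq>\<^sup>* q \<and> s \<preceq>\<^sup>* q \<and> separates A w s" "q \<in> Q i"
        then show "\<exists>w s. w \<preceq>\<^sup>* q \<and> s \<preceq>\<^sup>* q \<and> separates A w s" by simp
      qed
    qed simp
  qed
  then obtain A where A: "\<forall>i. i \<in> Field \<rho> \<longrightarrow> (\<forall>a\<in>A i. \<forall>b\<in>A i. a \<noteq> b \<longrightarrow> perp a b) \<and>
      dense_open {p. \<exists>a\<in>A i. p \<preceq>\<^sup>* a} \<and>
      (\<forall>q\<in>Q i. \<exists>w s. w \<preceq>\<^sup>* q \<and> s \<preceq>\<^sup>* q \<and> separates (A i) w s)"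
    by (auto simp only: choice_iff)
  have unique: "a = b" if "i \<in> Field \<rho>" "a \<in> A i" "b \<in> A i" "p \<preceq>\<^sup>* a" "p \<preceq>\<^sup>* b" for i a b p
  proof (rule ccontr)
    assume "a \<noteq> b"
    then have "perp a b" using A that by blast
    then show False using that(4,5) unfolding perp_def by blast
  qed
  define E where "E i = {p. \<exists>a\<in>A i. p \<preceq>\<^sup>* a}" for i
  have E: "dense_open (E i)" if "i \<in> Field \<rho>" for i
    using A that by (simp add: E_def)
  have split: "\<exists>i\<in>Field \<rho>. \<exists>w s. w \<preceq>\<^sup>* u \<and> s \<preceq>\<^sup>* u \<and> separates (A i) w s" if u: "u \<in> Conds" for u
  proof -
    obtain i where i: "i \<in> Field \<rho>" "u \<in> Q i" using subsetD[OF Q_Un u] by (rule UN_E)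
    then have "\<exists>w s. w \<preceq>\<^sup>* u \<and> s \<preceq>\<^sup>* u \<and> separates (A i) w s" using A by simp
    then show ?thesis using i(1) by (intro bexI)
  qed
  define D where "D j = {p \<in> Conds. \<forall>i\<in>underS \<rho> j. p \<in> E i}" for j
  have F: "i \<in> Field \<rho>" if "i \<in> underS \<rho> j" for i j
    using that by (auto simp: underS_def Field_def)
  have D_dense: "\<exists>w\<in>D j. w \<preceq>\<^sup>* p" if j: "j \<in> Field \<rho>" and p: "p \<in> Conds" for j p
  proof -
    obtain m where m: "m \<preceq>\<^sup>* p" "\<And>i. i \<in> underS \<rho> j \<Longrightarrow> m \<in> E i"
      by (rule distributive[OF small[OF j] _ p, of E], erule E[OF F], rule that) simp_all
    then show ?thesis using almost_Conds(1)[OF m(1)] by (auto simp: D_def)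
  qed
  have D: "dense_open (D j)" if j: "j \<in> Field \<rho>" for j
    unfolding dense_open_def
  proof (intro conjI ballI allI impI)
    show "D j \<subseteq> Conds" by (auto simp: D_def)
    show "\<exists>w\<in>D j. w \<preceq>\<^sup>* p" if "p \<in> Conds" for p using D_dense[OF j that] .
    show "q \<in> D j" if "p \<in> D j" "q \<preceq>\<^sup>* p" for p q
    proof -
      have "q \<in> E i" if i: "i \<in> underS \<rho> j" for i
      proof -
        have "p \<in> E i" using \<open>p \<in> D j\<close> i by (simp add: D_def)
        then show ?thesis using E[OF F[OF i]] \<open>q \<preceq>\<^sup>* p\<close> by (simp add: dense_open_def)
      qed
      then show ?thesis using almost_Conds(1)[OF \<open>q \<preceq>\<^sup>* p\<close>] by (simp add: D_def)
    qed
  qed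
  define val where "val j p = (\<lambda>i. if i \<in> underS \<rho> j then THE a. a \<in> A i \<and> p \<preceq>\<^sup>* a else undefined)" for j p
  have val: "val j p i = a" if "i \<in> underS \<rho> j" "a \<in> A i" "p \<preceq>\<^sup>* a" for j p i a
    unfolding val_def using that unique[OF F[OF that(1)]] by auto
  have val_below: "val j q = val j p" if p: "p \<in> D j" and q: "q \<preceq>\<^sup>* p" for j p q
  proof
    fix i
    show "val j q i = val j p i"
    proof (cases "i \<in> underS \<rho> j")
      case True
      then obtain a where a: "a \<in> A i" "p \<preceq>\<^sup>* a" using p by (auto simp: D_def E_def)
      then show ?thesis
        using val[OF True a] val[OF True a(1) almost_trans[OF q a(2)]] by simp
    qed (simp add: val_def)
  qed
  define V where "V j p = val j ` {d \<in> D j. d \<preceq>\<^sup>* p}" for j p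
  have many: "\<exists>j\<in>Field \<rho>. |Pow K| \<le>o |V j p|" if p: "p \<in> Conds" for p
  proof -
    obtain J f where J: "J \<subseteq> Field \<rho>" "|J| \<le>o |K|" and f: "\<And>X. X \<subseteq> K \<Longrightarrow> f X \<preceq>\<^sup>* p"
      and sep: "\<And>X Y. X \<subseteq> K \<Longrightarrow> Y \<subseteq> K \<Longrightarrow> X \<noteq> Y \<Longrightarrow> \<exists>i\<in>J. separates (A i) (f X) (f Y)"
      by (rule fusion[OF p split], assumption, rule that) simp_all
    obtain j where j: "j \<in> Field \<rho>" "J \<subseteq> underS \<rho> j"
      using bounded[OF J] by blast
    have "\<forall>X. \<exists>d. X \<subseteq> K \<longrightarrow> d \<in> D j \<and> d \<preceq>\<^sup>* f X"
      using D_dense[OF j(1) almost_Conds(1)[OF f]] by blast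
    then obtain g where g: "\<forall>X. X \<subseteq> K \<longrightarrow> g X \<in> D j \<and> g X \<preceq>\<^sup>* f X"
      unfolding choice_iff ..
    have "inj_on (\<lambda>X. val j (g X)) (Pow K)"
    proof (rule inj_onI, rule ccontr)
      fix X Y assume X: "X \<in> Pow K" and Y: "Y \<in> Pow K" and eq: "val j (g X) = val j (g Y)" and "X \<noteq> Y"
      then obtain i where i: "i \<in> J" "separates (A i) (f X) (f Y)" using sep[of X Y] by blast
      obtain a b where ab: "a \<in> A i" "b \<in> A i" "a \<noteq> b" and fa: "f X \<preceq>\<^sup>* a" "f Y \<preceq>\<^sup>* b"
        using i(2) by (rule separatesE)
      have "g X \<preceq>\<^sup>* a" "g Y \<preceq>\<^sup>* b"
        using almost_trans[OF _ fa(1)] almost_trans[OF _ fa(2)] g X Y by simp_all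
      then have "val j (g X) i = a" "val j (g Y) i = b"
        using ab(1,2) by (rule_tac [!] val[OF subsetD[OF j(2) i(1)]])
      then show False using eq ab(3) by simp
    qed
    moreover have "(\<lambda>X. val j (g X)) ` Pow K \<subseteq> V j p"
      using g almost_trans[OF _ f] unfolding V_def by blast
    ultimately have "|Pow K| \<le>o |V j p|"
      unfolding card_of_ordLeq[symmetric] by blast
    with j(1) show ?thesis by blast
  qed
  have "|Conds \<times> Pow K| \<le>o |Pow K|"
    using infinite_K card by (intro card_of_Times_ordLeq_infinite_Field)
      (simp_all add: Field_card_of card_of_card_order_on card_of_refl ordIso_imp_ordLeq)
  define T where "T j = {t \<in> Conds \<times> Pow K. |Pow K| \<le>o |V j (fst t)| }" for j
  have T: "|T j| \<le>o |Pow K|" for j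
    by (rule ordLeq_transitive[OF card_of_mono1 \<open>|Conds \<times> Pow K| \<le>o |Pow K|\<close>]) (auto simp: T_def)
  have "\<forall>j. \<exists>g. inj_on g (T j) \<and> (\<forall>t\<in>T j. g t \<in> V j (fst t))"
  proof
    fix j
    obtain g where g: "inj_on g (T j)" "\<And>t. t \<in> T j \<Longrightarrow> g t \<in> V j (fst t)"
      by (rule injective_choice[OF T[of j], of "\<lambda>t. V j (fst t)"], simp add: T_def, rule that) simp_all
    then show "\<exists>g. inj_on g (T j) \<and> (\<forall>t\<in>T j. g t \<in> V j (fst t))"
      by (intro exI[of _ g]) simp
  qed
  then obtain g where g: "\<forall>j. inj_on (g j) (T j) \<and> (\<forall>t\<in>T j. g j t \<in> V j (fst t))"
    unfolding choice_iff ..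
  \<comment> \<open>Values that are not reserved get the label \<open>{}\<close>, an arbitrary subset of \<open>K\<close>.\<close>
  define v where "v j p = (if val j p \<in> g j ` T j then snd (inv_into (T j) (g j) (val j p)) else {})" for j p
  show ?thesis
  proof (rule that[of D v]; intro ballI allI impI)
    show "v j p \<subseteq> K" for j p
    proof (cases "val j p \<in> g j ` T j")
      case True
      then have "inv_into (T j) (g j) (val j p) \<in> T j" by (rule inv_into_into)
      then show ?thesis using True by (auto simp: v_def T_def)
    qed (simp add: v_def)
    show "v j q = v j p" if "p \<in> D j" "q \<preceq>\<^sup>* p" for j p q
      unfolding v_def val_below[OF that] ..
    show "\<exists>j\<in>Field \<rho>. \<exists>d\<in>D j. d \<preceq>\<^sup>* p \<and> v j d = X" if p: "p \<in> Conds" and X: "X \<in> Pow K" for p X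
    proof -
      obtain j where j: "j \<in> Field \<rho>" "|Pow K| \<le>o |V j p|" using many[OF p] by blast
      have t: "(p, X) \<in> T j"
        using p X j by (simp add: T_def)
      then have "g j (p, X) \<in> V j p" using g by fastforce
      then obtain d where d: "d \<in> D j" "d \<preceq>\<^sup>* p" "val j d = g j (p, X)"
        by (auto simp: V_def)
      have "inv_into (T j) (g j) (g j (p, X)) = (p, X)"
        using g t by (intro inv_into_f_f) simp_all
      then have "v j d = X"
        using t by (simp add: v_def d(3))
      with j d show ?thesis by blast
    qed
  qed (rule D)
qed

end

section \<open>The forcing relation\<close>

locale forcing =
  fixes R :: "'p rel"
  assumes forcing_notion: "forcing_notion R"
begin

abbreviation ext :: "'p \<Rightarrow> 'p \<Rightarrow> bool" (infix "\<preceq>" 50) where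
  "q \<preceq> p \<equiv> (q, p) \<in> R"

lemma ext_refl: "p \<in> Field R \<Longrightarrow> p \<preceq> p"
  using forcing_notion
  by (auto simp: forcing_notion_def partial_order_on_def preorder_on_def refl_on_def)

lemma ext_refl_left: "q \<preceq> p \<Longrightarrow> q \<preceq> q"
  by (rule ext_refl) (auto simp: Field_def)

lemma ext_trans: "r \<preceq> q \<Longrightarrow> q \<preceq> p \<Longrightarrow> r \<preceq> p"
  using forcing_notion
  by (auto simp: forcing_notion_def partial_order_on_def preorder_on_def dest: transD)

lemma ext_Field: "q \<preceq> p \<Longrightarrow> q \<in> Field R" "q \<preceq> p \<Longrightarrow> p \<in> Field R"
  by (auto simp: Field_def)

lemma top_cond: "top_cond R \<in> Field R" "p \<in> Field R \<Longrightarrow> p \<preceq> top_cond R"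
proof -
  obtain m where m: "is_top R m"
    using forcing_notion by (auto simp: forcing_notion_def)
  have "top_cond R = m"
    using top_cond_eq[OF forcing_notion m] .
  with m show "top_cond R \<in> Field R" "p \<in> Field R \<Longrightarrow> p \<preceq> top_cond R"
    by (auto simp: is_top_def)
qed

lemma dense_belowI: "(\<And>u. u \<preceq> p \<Longrightarrow> u \<in> D) \<Longrightarrow> dense_below R p D"
  unfolding dense_below_def using ext_refl_left by blast

lemma dense_below_UNIV [simp]: "dense_below R p UNIV"
  by (simp add: dense_belowI)

lemma dense_below_ext: "dense_below R p D \<Longrightarrow> q \<preceq> p \<Longrightarrow> dense_below R q D"
  unfolding dense_below_def using ext_trans by blast

lemma dense_below_bind:
  assumes "dense_below R p D" "\<And>u. u \<in> D \<Longrightarrow> u \<preceq> p \<Longrightarrow> dense_below R u D'"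
  shows "dense_below R p D'"
  unfolding dense_below_def
proof (intro allI impI)
  fix q assume q: "q \<preceq> p"
  then obtain u where u: "u \<in> D" "u \<preceq> q"
    using assms(1) by (auto simp: dense_below_def)
  then have "dense_below R u D'"
    using assms(2) ext_trans[OF _ q] by blast
  then obtain u' where "u' \<in> D'" "u' \<preceq> u"
    using ext_refl_left[OF u(2)] by (auto simp: dense_below_def)
  then show "\<exists>u\<in>D'. u \<preceq> q"
    using u ext_trans by blast
qed

lemma dense_below_weaken:
  assumes "dense_below R p D" "\<And>u. u \<in> D \<Longrightarrow> u \<preceq> p \<Longrightarrow> u \<in> D'"
  shows "dense_below R p D'"
  using assms ext_trans unfolding dense_below_def by metis

lemma dense_below_cong:
  "(\<And>u. u \<preceq> p \<Longrightarrow> u \<in> D \<longleftrightarrow> u \<in> D') \<Longrightarrow> dense_below R p D \<longleftrightarrow> dense_below R p D'"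
  using dense_below_weaken[of p D D'] dense_below_weaken[of p D' D] by blast

lemma forces_mem_ext: "forces_mem R x y p \<Longrightarrow> q \<preceq> p \<Longrightarrow> forces_mem R x y q"
  unfolding forces_mem_def by (rule dense_below_ext)

lemma forces_mem_local:
  "dense_below R p {u. forces_mem R x y u} \<Longrightarrow> forces_mem R x y p"
  unfolding forces_mem_def by (erule dense_below_bind) simp

lemma forces_eq_ext: "forces_eq R x y p \<Longrightarrow> q \<preceq> p \<Longrightarrow> forces_eq R x y q"
  unfolding forces_eq_iff[of R x y] using ext_trans by blast

lemmas forces_eq_symD = forces_eq_sym[THEN iffD1]

lemma forces_eqD1:
  "forces_eq R x y p \<Longrightarrow> i \<in> idx x \<Longrightarrow> p \<preceq> cond x i \<Longrightarrow> forces_mem R (sub x i) y p"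
  unfolding forces_eq_iff[of R x y] using ext_refl_left by blast

lemma forces_eq_local:
  fixes x y :: "('i, 'p) name"
  assumes "dense_below R p {u. forces_eq R x y u}"
  shows "forces_eq R x y p"
proof -
  have *: "forces_mem R (sub a i) b q"
    if "dense_below R p {u. forces_eq R a b u}" "i \<in> idx a" "q \<preceq> p" "q \<preceq> cond a i"
    for a b :: "('i, 'p) name" and i q
  proof (rule forces_mem_local, rule dense_below_weaken)
    show "dense_below R q {u. forces_eq R a b u}"
      using that dense_below_ext by blast
    show "u \<in> {u. forces_mem R (sub a i) b u}" if "u \<in> {u. forces_eq R a b u}" "u \<preceq> q" for u
      using forces_eqD1[OF _ \<open>i \<in> idx a\<close> ext_trans[OF that(2) \<open>q \<preceq> cond a i\<close>]] that(1) by simp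
  qed
  have "dense_below R p {u. forces_eq R y x u}"
    using assms by (simp add: forces_eq_sym[of R y x])
  then show ?thesis
    unfolding forces_eq_iff[of R x y] using *[OF assms] *[of y x] by blast
qed

lemma forces_eq_refl: "forces_eq R x x p"
proof (induction x arbitrary: p)
  case Empty
  then show ?case by simp
next
  case (Name I x c)
  have "dense_below R q {u. \<exists>j\<in>I. u \<preceq> c j \<and> forces_eq R (x i) (x j) u}"
       "dense_below R q {u. \<exists>j\<in>I. u \<preceq> c j \<and> forces_eq R (x j) (x i) u}"
    if "i \<in> I" "q \<preceq> c i" for i q
    using that Name ext_trans by (blast intro!: dense_belowI)+
  then show ?case by auto
qed

declare forces_eq_refl [simp]

text \<open>
  Induction on the first name: an element of \<open>x\<close> is forced into \<open>y\<close> and from there into \<open>z\<close>, on dense sets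
  of conditions.
\<close>

lemma forces_eq_trans:
  "forces_eq R x y p \<Longrightarrow> forces_eq R y z p \<Longrightarrow> forces_eq R x z p"
proof (induction x arbitrary: y z p)
  case Empty
  have "forces_mem R (sub z k) Empty q" if k: "k \<in> idx z" "q \<preceq> p" "q \<preceq> cond z k" for k q
    unfolding forces_mem_def
  proof (rule dense_below_bind)
    show "dense_below R q {u. \<exists>j\<in>idx y. u \<preceq> cond y j \<and> forces_eq R (sub z k) (sub y j) u}"
      using Empty(2) k unfolding forces_eq_iff[of R y z] forces_mem_def by blast
    show "dense_below R u {u. \<exists>j\<in>idx Empty. u \<preceq> cond Empty j \<and> forces_eq R (sub z k) (sub Empty j) u}"
      if "u \<in> {u. \<exists>j\<in>idx y. u \<preceq> cond y j \<and> forces_eq R (sub z k) (sub y j) u}" "u \<preceq> q" for u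
    proof -
      obtain j where "j \<in> idx y" "u \<preceq> cond y j"
        using \<open>u \<in> _\<close> by blast
      moreover have "u \<preceq> p"
        using that k ext_trans by blast
      ultimately have "forces_mem R (sub y j) Empty u"
        using Empty(1) unfolding forces_eq_iff[of R Empty y] by blast
      then show ?thesis
        by (simp add: forces_mem_def)
    qed
  qed
  then show ?case
    unfolding forces_eq_iff[of R Empty z] by simp
next
  case (Name I x c)
  let ?x = "Name I x c"
  have "forces_mem R (x i) z q" if i: "i \<in> I" "q \<preceq> p" "q \<preceq> c i" for i q
    unfolding forces_mem_def
  proof (rule dense_below_bind)
    show "dense_below R q {u. \<exists>j\<in>idx y. u \<preceq> cond y j \<and> forces_eq R (x i) (sub y j) u}"
      using Name(2) i unfolding forces_eq_iff[of R ?x y] forces_mem_def by simp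
    fix u assume "u \<in> {u. \<exists>j\<in>idx y. u \<preceq> cond y j \<and> forces_eq R (x i) (sub y j) u}" "u \<preceq> q"
    then obtain j where j: "j \<in> idx y" "u \<preceq> cond y j" "forces_eq R (x i) (sub y j) u" "u \<preceq> p"
      using i ext_trans by blast
    then have "forces_mem R (sub y j) z u"
      using Name(3) unfolding forces_eq_iff[of R y z] by blast
    then show "dense_below R u {u. \<exists>j\<in>idx z. u \<preceq> cond z j \<and> forces_eq R (x i) (sub z j) u}"
      unfolding forces_mem_def
      by (rule dense_below_weaken) (use Name(1) i(1) forces_eq_ext[OF j(3)] in blast)
  qed
  moreover have "forces_mem R (sub z k) ?x q" if k: "k \<in> idx z" "q \<preceq> p" "q \<preceq> cond z k" for k q
    unfolding forces_mem_def
  proof (rule dense_below_bind)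
    show "dense_below R q {u. \<exists>j\<in>idx y. u \<preceq> cond y j \<and> forces_eq R (sub z k) (sub y j) u}"
      using Name(3) k unfolding forces_eq_iff[of R y z] forces_mem_def by blast
    fix u assume "u \<in> {u. \<exists>j\<in>idx y. u \<preceq> cond y j \<and> forces_eq R (sub z k) (sub y j) u}" "u \<preceq> q"
    then obtain j where j: "j \<in> idx y" "u \<preceq> cond y j" "forces_eq R (sub z k) (sub y j) u" "u \<preceq> p"
      using k ext_trans by blast
    then have "forces_mem R (sub y j) ?x u"
      using Name(2) unfolding forces_eq_iff[of R ?x y] by blast
    then show "dense_below R u {u. \<exists>j\<in>idx ?x. u \<preceq> cond ?x j \<and> forces_eq R (sub z k) (sub ?x j) u}"
      unfolding forces_mem_def
    proof (rule dense_below_weaken)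
      fix u' assume "u' \<in> {u. \<exists>j'\<in>idx ?x. u \<preceq> cond ?x j' \<and> forces_eq R (sub y j) (sub ?x j') u}" "u' \<preceq> u"
      then obtain i where i: "i \<in> I" "u' \<preceq> c i" "forces_eq R (sub y j) (x i) u'" "u' \<preceq> u"
        by auto
      have "forces_eq R (x i) (sub y j) u'" "forces_eq R (sub y j) (sub z k) u'"
        by (rule forces_eq_symD[OF i(3)], rule forces_eq_symD[OF forces_eq_ext[OF j(3) i(4)]])
      then have "forces_eq R (x i) (sub z k) u'"
        by (rule Name(1)[OF rangeI])
      then show "u' \<in> {u. \<exists>j\<in>idx ?x. u \<preceq> cond ?x j \<and> forces_eq R (sub z k) (sub ?x j) u}"
        using i(1,2) by (auto dest: forces_eq_symD)
    qed
  qed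
  ultimately show ?case
    unfolding forces_eq_iff[of R ?x z] by simp
qed

lemma forces_mem_cong_left:
  assumes "forces_eq R x x' p" "forces_mem R x y p"
  shows "forces_mem R x' y p"
  using assms(2) unfolding forces_mem_def
proof (rule dense_below_weaken)
  fix u assume u: "u \<in> {u. \<exists>j\<in>idx y. u \<preceq> cond y j \<and> forces_eq R x (sub y j) u}" "u \<preceq> p"
  have "forces_eq R x' x u"
    by (rule forces_eq_symD[OF forces_eq_ext[OF assms(1) u(2)]])
  then show "u \<in> {u. \<exists>j\<in>idx y. u \<preceq> cond y j \<and> forces_eq R x' (sub y j) u}"
    using u(1) forces_eq_trans by blast
qed

lemma forces_mem_cong_right:
  assumes "forces_eq R y y' p" "forces_mem R x y p"
  shows "forces_mem R x y' p"
proof (rule forces_mem_local, rule dense_below_weaken)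
  show "dense_below R p {u. \<exists>j\<in>idx y. u \<preceq> cond y j \<and> forces_eq R x (sub y j) u}"
    using assms(2) by (simp add: forces_mem_def)
  fix u assume u: "u \<in> {u. \<exists>j\<in>idx y. u \<preceq> cond y j \<and> forces_eq R x (sub y j) u}" "u \<preceq> p"
  then obtain j where j: "j \<in> idx y" "u \<preceq> cond y j" "forces_eq R x (sub y j) u"
    by blast
  have "forces_mem R (sub y j) y' u"
    by (rule forces_eqD1[OF forces_eq_ext[OF assms(1) u(2)] j(1,2)])
  then show "u \<in> {u. forces_mem R x y' u}"
    using forces_mem_cong_left[OF forces_eq_symD[OF j(3)]] by simp
qed

lemma forces_ext: "forces R f p \<Longrightarrow> q \<preceq> p \<Longrightarrow> forces R f q"
proof (induction f arbitrary: p q)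
  case (Mem x y)
  then show ?case unfolding forces.simps by (rule forces_mem_ext)
next
  case (Eq x y)
  then show ?case unfolding forces.simps by (rule forces_eq_ext)
next
  case (Neg f)
  then show ?case unfolding forces.simps using ext_trans by blast
next
  case (Conj f g)
  then show ?case unfolding forces.simps by blast
next
  case (Forall F)
  then show ?case unfolding forces.simps by blast
qed

text \<open>
  Together with \<open>forces_ext\<close> this lets one argue about forced statements after passing to extensions
  that decide the case distinctions at hand.
\<close>

lemma forces_local:
  fixes f :: "('i, 'p) fm"
  shows "dense_below R p {u. forces R f u} \<Longrightarrow> forces R f p"
proof (induction f arbitrary: p)
  case (Neg f)
  show ?case unfolding forces.simps
  proof (intro allI impI notI)
    fix q assume q: "q \<preceq> p" "forces R f q"
    then obtain u where "forces R (Neg f) u" "u \<preceq> q"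
      using Neg.prems unfolding dense_below_def by blast
    then show False
      using forces_ext[OF q(2)] ext_refl_left unfolding forces.simps by blast
  qed
next
  case (Conj f g)
  have "dense_below R p {u. forces R f u}" "dense_below R p {u. forces R g u}"
    by (rule dense_below_weaken[OF Conj.prems], simp)+
  then show ?case
    using Conj.IH by simp
next
  case (Forall F)
  show ?case unfolding forces.simps
  proof (intro allI impI)
    fix x :: "('i, 'p) name" assume "is_name R x"
    then have "dense_below R p {u. forces R (F x) u}"
      by (intro dense_below_weaken[OF Forall.prems]) simp
    then show "forces R (F x) p"
      using Forall.IH by blast
  qed
next
  case (Mem x y)
  then show ?case by (simp add: forces_mem_local)
next
  case (Eq x y)
  then show ?case by (simp add: forces_eq_local)
qed

lemma forces_Disj: "forces R (Disj f g) p \<longleftrightarrow> dense_below R p {u. forces R f u \<or> forces R g u}"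
proof -
  have "(\<forall>u. u \<preceq> q \<longrightarrow> \<not> forces R f u) \<and> (\<forall>u. u \<preceq> q \<longrightarrow> \<not> forces R g u) \<longleftrightarrow>
        (\<forall>u. u \<preceq> q \<longrightarrow> \<not> (forces R f u \<or> forces R g u))" for q
    by blast
  then show ?thesis
    unfolding Disj_def forces.simps dense_below_def by blast
qed

lemma forces_Imp: "forces R (Imp f g) p \<longleftrightarrow> (\<forall>q. q \<preceq> p \<longrightarrow> forces R f q \<longrightarrow> forces R g q)"
proof
  assume *: "forces R (Imp f g) p"
  show "\<forall>q. q \<preceq> p \<longrightarrow> forces R f q \<longrightarrow> forces R g q"
  proof (intro allI impI)
    fix q assume q: "q \<preceq> p" "forces R f q"
    have "dense_below R q {u. forces R g u}"
      unfolding dense_below_def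
    proof (intro allI impI)
      fix q' assume q': "q' \<preceq> q"
      then have "q' \<preceq> p" "forces R f q'"
        using q ext_trans forces_ext by blast+
      with * show "\<exists>u\<in>{u. forces R g u}. u \<preceq> q'"
        by (auto simp: Imp_def)
    qed
    then show "forces R g q" by (rule forces_local)
  qed
next
  assume "\<forall>q. q \<preceq> p \<longrightarrow> forces R f q \<longrightarrow> forces R g q"
  then show "forces R (Imp f g) p"
    using ext_refl_left by (auto simp: Imp_def)
qed

lemma forces_Exi: 
  "forces R (Exi F) p \<longleftrightarrow> dense_below R p {u. \<exists>x. is_name R x \<and> forces R (F x) u}"
  unfolding Exi_def forces.simps dense_below_def by blast

lemma forces_AllIn:
  "forces R (AllIn a F) p \<longleftrightarrow>
     (\<forall>x. is_name R x \<longrightarrow> (\<forall>q. q \<preceq> p \<longrightarrow> forces_mem R x a q \<longrightarrow> forces R (F x) q))"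
  by (simp add: AllIn_def forces_Imp)

lemma forces_ExiIn:
  "forces R (ExiIn a F) p \<longleftrightarrow>
     dense_below R p {u. \<exists>x. is_name R x \<and> forces_mem R x a u \<and> forces R (F x) u}"
  by (simp add: ExiIn_def forces_Exi)

lemma forces_UPair:
  "forces R (UPair_fm a b z) p \<longleftrightarrow>
     (\<forall>w. is_name R w \<longrightarrow> (\<forall>q. q \<preceq> p \<longrightarrow>
        (forces_mem R w z q \<longleftrightarrow> dense_below R q {u. forces_eq R w a u \<or> forces_eq R w b u})))"
  by (auto simp: UPair_fm_def Iff_def forces_Imp forces_Disj)

section \<open>Ordered pairs\<close>

lemma is_name_iff:
  "is_name R x \<longleftrightarrow> (\<forall>i\<in>idx x. cond x i \<in> Field R \<and> is_name R (sub x i))"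
  by (cases x) auto

text \<open>
  A name with two elements needs two distinct indices \<open>i0\<close> and \<open>i1\<close>.
\<close>

definition upair :: "'i \<Rightarrow> 'i \<Rightarrow> ('i, 'p) name \<Rightarrow> ('i, 'p) name \<Rightarrow> ('i, 'p) name" where
  "upair i0 i1 a b = Name {i0, i1} (\<lambda>i. if i = i0 then a else b) (\<lambda>_. top_cond R)"

definition opair :: "'i \<Rightarrow> 'i \<Rightarrow> ('i, 'p) name \<Rightarrow> ('i, 'p) name \<Rightarrow> ('i, 'p) name" where
  "opair i0 i1 a b = upair i0 i1 (upair i0 i1 a a) (upair i0 i1 a b)"

lemma is_name_upair: "is_name R a \<Longrightarrow> is_name R b \<Longrightarrow> is_name R (upair i0 i1 a b)"
  by (simp add: upair_def top_cond)

lemma is_name_opair: "is_name R a \<Longrightarrow> is_name R b \<Longrightarrow> is_name R (opair i0 i1 a b)"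
  by (simp add: opair_def is_name_upair)

lemma forces_mem_upair:
  assumes "i0 \<noteq> i1"
  shows "forces_mem R w (upair i0 i1 a b) p \<longleftrightarrow>
    dense_below R p {u. forces_eq R w a u \<or> forces_eq R w b u}"
proof -
  have "(\<exists>j\<in>idx (upair i0 i1 a b). u \<preceq> cond (upair i0 i1 a b) j \<and>
      forces_eq R w (sub (upair i0 i1 a b) j) u) \<longleftrightarrow> forces_eq R w a u \<or> forces_eq R w b u"
    if "u \<preceq> p" for u
    using assms top_cond(2)[OF ext_Field(1)[OF that]] by (simp add: upair_def)
  then show ?thesis
    unfolding forces_mem_def by (intro dense_below_cong) simp
qed

lemma forces_eq_cases:
  assumes "dense_below R p {u. \<Phi> u \<or> \<Psi> u}"
    and "\<And>u. u \<preceq> p \<Longrightarrow> \<Phi> u \<Longrightarrow> forces_eq R a b u"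
    and "\<And>u. u \<preceq> p \<Longrightarrow> \<Psi> u \<Longrightarrow> forces_eq R a b u"
  shows "forces_eq R a b p"
  by (rule forces_eq_local, rule dense_below_weaken[OF assms(1)]) (use assms(2,3) in blast)

lemma dense_below_eq_cong:
  assumes "forces_eq R a a' p" "forces_eq R b b' p"
    and "dense_below R p {u. forces_eq R w a u \<or> forces_eq R w b u}"
  shows "dense_below R p {u. forces_eq R w a' u \<or> forces_eq R w b' u}"
  using assms(3)
proof (rule dense_below_weaken)
  fix u assume "u \<in> {u. forces_eq R w a u \<or> forces_eq R w b u}" and u: "u \<preceq> p"
  then show "u \<in> {u. forces_eq R w a' u \<or> forces_eq R w b' u}"
    using forces_eq_trans[of w a u a', OF _ forces_eq_ext[OF assms(1) u]]
      forces_eq_trans[of w b u b', OF _ forces_eq_ext[OF assms(2) u]] by auto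
qed

lemma dense_below_eq_same:
  "dense_below R p {u. forces_eq R w a u \<or> forces_eq R w a u} \<longleftrightarrow> forces_eq R w a p"
proof
  assume "forces_eq R w a p"
  then show "dense_below R p {u. forces_eq R w a u \<or> forces_eq R w a u}"
    by (intro dense_belowI) (simp add: forces_eq_ext)
qed (simp add: forces_eq_local)

lemma forces_UPair_upair:
  assumes "i0 \<noteq> i1" "forces_eq R a a' p" "forces_eq R b b' p"
  shows "forces R (UPair_fm a b (upair i0 i1 a' b')) p"
  unfolding forces_UPair forces_mem_upair[OF assms(1)]
proof (intro allI impI)
  fix w q assume q: "q \<preceq> p"
  note e = forces_eq_ext[OF assms(2) q] forces_eq_ext[OF assms(3) q]
  show "dense_below R q {u. forces_eq R w a' u \<or> forces_eq R w b' u} =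
        dense_below R q {u. forces_eq R w a u \<or> forces_eq R w b u}"
    using dense_below_eq_cong[OF e] dense_below_eq_cong[OF forces_eq_symD[OF e(1)] forces_eq_symD[OF e(2)]]
    by blast
qed

lemma forces_UPair_cong:
  fixes a b z z' :: "('i, 'p) name"
  assumes "forces R (UPair_fm a b z) p" "forces_eq R z z' p"
  shows "forces R (UPair_fm a b z') p"
  unfolding forces_UPair
proof (intro allI impI)
  fix w :: "('i, 'p) name" and q assume w: "is_name R w" and q: "q \<preceq> p"
  note e = forces_eq_ext[OF assms(2) q]
  have "forces_mem R w z' q = forces_mem R w z q"
    using forces_mem_cong_right[OF e] forces_mem_cong_right[OF forces_eq_symD[OF e]] by blast
  then show "forces_mem R w z' q = dense_below R q {u. forces_eq R w a u \<or> forces_eq R w b u}"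
    using assms(1) w q unfolding forces_UPair by blast
qed

lemma forces_Pair:
  fixes a b z :: "('i, 'p) name"
  shows "forces R (Pair_fm a b z) p \<longleftrightarrow> dense_below R p {u. \<exists>x y. is_name R x \<and> is_name R y \<and>
    forces R (UPair_fm a a x) u \<and> forces R (UPair_fm a b y) u \<and> forces R (UPair_fm x y z) u}"
    (is "_ \<longleftrightarrow> dense_below R p ?D")
proof -
  let ?E = "\<lambda>x. {u. \<exists>y. is_name R y \<and>
    forces R (UPair_fm a a x) u \<and> forces R (UPair_fm a b y) u \<and> forces R (UPair_fm x y z) u}"
  have *: "forces R (Pair_fm a b z) p \<longleftrightarrow> dense_below R p {u. \<exists>x. is_name R x \<and> dense_below R u (?E x)}"
    unfolding Pair_fm_def forces_Exi forces.simps ..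
  show ?thesis
  proof
    assume "dense_below R p ?D"
    then show "forces R (Pair_fm a b z) p"
      unfolding *
    proof (rule dense_below_weaken)
      fix u assume "u \<in> ?D"
      then obtain x where x: "is_name R x" and "u \<in> ?E x"
        by blast
      then have "dense_below R u (?E x)"
        by (intro dense_belowI) (auto dest: forces_ext)
      with x show "u \<in> {u. \<exists>x. is_name R x \<and> dense_below R u (?E x)}"
        by blast
    qed
  next
    assume "forces R (Pair_fm a b z) p"
    then show "dense_below R p ?D"
      unfolding *
    proof (rule dense_below_bind)
      fix u assume "u \<in> {u. \<exists>x. is_name R x \<and> dense_below R u (?E x)}"
      then obtain x where x: "is_name R x" and "dense_below R u (?E x)"
        by blast
      from this(2) show "dense_below R u ?D"
        by (rule dense_below_weaken) (use x in blast)
    qed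
  qed
qed

lemma forces_Pair_cong:
  assumes "forces R (Pair_fm a b z) p" "forces_eq R z z' p"
  shows "forces R (Pair_fm a b z') p"
  using assms(1) unfolding forces_Pair
proof (rule dense_below_weaken)
  fix u
  assume "u \<in> {u. \<exists>x y. is_name R x \<and> is_name R y \<and> forces R (UPair_fm a a x) u \<and>
    forces R (UPair_fm a b y) u \<and> forces R (UPair_fm x y z) u}" and u: "u \<preceq> p"
  then show "u \<in> {u. \<exists>x y. is_name R x \<and> is_name R y \<and> forces R (UPair_fm a a x) u \<and>
    forces R (UPair_fm a b y) u \<and> forces R (UPair_fm x y z') u}"
    using forces_UPair_cong[OF _ forces_eq_ext[OF assms(2) u]] by blast
qed

text \<open>
  This is the usual proof that a Kuratowski pair determines its components. Each of its case distinctions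
  holds only on a dense set of conditions, so \<open>forces_eq_cases\<close> takes the place of a disjunction, and the
  equalities already known are carried to the extensions.
\<close>

lemma kuratowski_pair_eq:
  fixes a b a' b' U V :: "('i, 'p) name"
  assumes i: "i0 \<noteq> i1"
    and names: "is_name R a" "is_name R b" "is_name R a'" "is_name R b'" "is_name R U" "is_name R V"
    and U: "forces R (UPair_fm a a U) p" and V: "forces R (UPair_fm a b V) p"
    and Z: "forces R (UPair_fm U V (opair i0 i1 a' b')) p"
    and p: "p \<in> Field R"
  shows "forces_eq R a a' p \<and> forces_eq R b b' p"
proof -
  define U' V' where "U' = upair i0 i1 a' a'" and "V' = upair i0 i1 a' b'"
  have names': "is_name R U'" "is_name R V'"
    using names by (simp_all add: U'_def V'_def is_name_upair)
  have U: "forces_mem R w U q \<longleftrightarrow> forces_eq R w a q"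
    if "is_name R w" "q \<preceq> p" for w :: "('i, 'p) name" and q
    using U that unfolding forces_UPair dense_below_eq_same by blast
  have V: "forces_mem R w V q \<longleftrightarrow> dense_below R q {u. forces_eq R w a u \<or> forces_eq R w b u}"
    if "is_name R w" "q \<preceq> p" for w :: "('i, 'p) name" and q
    using V that unfolding forces_UPair by blast
  have U': "forces_mem R w U' q \<longleftrightarrow> forces_eq R w a' q" for w q
    unfolding U'_def forces_mem_upair[OF i] dense_below_eq_same ..
  have V': "forces_mem R w V' q \<longleftrightarrow> dense_below R q {u. forces_eq R w a' u \<or> forces_eq R w b' u}" for w q
    unfolding V'_def forces_mem_upair[OF i] ..
  have Z: "dense_below R q {u. forces_eq R w U u \<or> forces_eq R w V u} \<longleftrightarrow>
      dense_below R q {u. forces_eq R w U' u \<or> forces_eq R w V' u}"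
    if "is_name R w" "q \<preceq> p" for w :: "('i, 'p) name" and q
    using Z that unfolding forces_UPair opair_def forces_mem_upair[OF i] U'_def V'_def by blast
  have pp: "p \<preceq> p" using p by (rule ext_refl)
  have aV: "forces_mem R a V q" and bV: "forces_mem R b V q" and aU: "forces_mem R a U q"
    if "q \<preceq> p" for q
    using that names
    by (auto simp: V U)
  have aV': "forces_mem R a' V' q" and bV': "forces_mem R b' V' q" for q
    by (auto simp: V')
  have eq_a: "forces_eq R a a' p"
  proof (rule forces_eq_cases)
    show "dense_below R p {u. forces_eq R U U' u \<or> forces_eq R U V' u}"
      using Z[OF names(5) pp] by simp
    show "forces_eq R a a' u" if "u \<preceq> p" "forces_eq R U U' u" for u
      using forces_mem_cong_right[OF that(2) aU[OF that(1)]] by (simp add: U')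
    show "forces_eq R a a' u" if "u \<preceq> p" "forces_eq R U V' u" for u
      using forces_mem_cong_right[OF forces_eq_symD[OF that(2)] aV'] U[OF names(3) that(1)]
        forces_eq_symD[of R a' a u] by blast
  qed
  have "forces_eq R b b' p"
  proof (rule forces_eq_cases)
    show "dense_below R p {u. forces_eq R V U' u \<or> forces_eq R V V' u}"
      using Z[OF names(6) pp] by simp
  next
    fix u assume u: "u \<preceq> p" and VU': "forces_eq R V U' u"
    have ba': "forces_eq R b a' u"
      using forces_mem_cong_right[OF VU' bV[OF u]] by (simp add: U')
    show "forces_eq R b b' u"
    proof (rule forces_eq_cases)
      show "dense_below R u {u. forces_eq R V' U u \<or> forces_eq R V' V u}"
        using Z[OF names'(2) u] by simp
    next
      fix v assume v: "v \<preceq> u" and e: "forces_eq R V' U v"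
      have vp: "v \<preceq> p" using v u by (rule ext_trans)
      have "forces_eq R b' a v"
        using forces_mem_cong_right[OF e bV'] U[OF names(4) vp] by blast
      then have "forces_eq R b' a' v"
        using forces_eq_ext[OF eq_a vp] by (rule forces_eq_trans)
      then show "forces_eq R b b' v"
        by (rule forces_eq_trans[OF forces_eq_ext[OF ba' v] forces_eq_symD])
    next
      fix v assume v: "v \<preceq> u" and e: "forces_eq R V' V v"
      have "forces_eq R b' a' v"
        using forces_mem_cong_right[OF forces_eq_trans[OF e forces_eq_ext[OF VU' v]] bV'] by (simp add: U')
      then show "forces_eq R b b' v"
        by (rule forces_eq_trans[OF forces_eq_ext[OF ba' v] forces_eq_symD])
    qed
  next
    fix u assume u: "u \<preceq> p" and VV': "forces_eq R V V' u"
    show "forces_eq R b b' u"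
    proof (rule forces_eq_cases)
      show "dense_below R u {u. forces_eq R b a' u \<or> forces_eq R b b' u}"
        using forces_mem_cong_right[OF VV' bV[OF u]] by (simp add: V')
    next
      fix v assume v: "v \<preceq> u" and ba': "forces_eq R b a' v"
      have vp: "v \<preceq> p" using v u by (rule ext_trans)
      show "forces_eq R b b' v"
      proof (rule forces_eq_cases)
        show "dense_below R v {u. forces_eq R b' a u \<or> forces_eq R b' b u}"
          using forces_mem_cong_right[OF forces_eq_symD[OF forces_eq_ext[OF VV' v]] bV'] V[OF names(4) vp]
          by blast
      next
        fix t assume t: "t \<preceq> v" and "forces_eq R b' a t"
        then have "forces_eq R b' a' t"
          using forces_eq_trans forces_eq_ext[OF eq_a ext_trans[OF t vp]] by blast
        then show "forces_eq R b b' t"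
          by (rule forces_eq_trans[OF forces_eq_ext[OF ba' t] forces_eq_symD])
      next
        fix t assume "forces_eq R b' b t"
        then show "forces_eq R b b' t" by (rule forces_eq_symD)
      qed
    qed
  qed
  with eq_a show ?thesis ..
qed

lemma forces_Pair_opair:
  assumes i: "i0 \<noteq> i1" and p: "p \<in> Field R"
    and names: "is_name R a" "is_name R b" "is_name R a'" "is_name R b'"
  shows "forces R (Pair_fm a b (opair i0 i1 a' b')) p \<longleftrightarrow> forces_eq R a a' p \<and> forces_eq R b b' p"
proof
  let ?D = "{u. forces_eq R a a' u \<and> forces_eq R b b' u}"
  assume "forces R (Pair_fm a b (opair i0 i1 a' b')) p"
  then have "dense_below R p ?D"
    unfolding forces_Pair
  proof (rule dense_below_weaken)
    fix u assume "u \<in> {u. \<exists>x y. is_name R x \<and> is_name R y \<and> forces R (UPair_fm a a x) u \<and>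
      forces R (UPair_fm a b y) u \<and> forces R (UPair_fm x y (opair i0 i1 a' b')) u}" "u \<preceq> p"
    then show "u \<in> ?D"
      using kuratowski_pair_eq[OF i names] ext_Field(1) by blast
  qed
  then have "dense_below R p {u. forces_eq R a a' u}" "dense_below R p {u. forces_eq R b b' u}"
    by (rule dense_below_weaken, simp)+
  then show "forces_eq R a a' p \<and> forces_eq R b b' p"
    using forces_eq_local by blast
next
  assume e: "forces_eq R a a' p \<and> forces_eq R b b' p"
  let ?U = "upair i0 i1 a' a'" and ?V = "upair i0 i1 a' b'"
  have *: "forces R (UPair_fm a a ?U) u \<and> forces R (UPair_fm a b ?V) u \<and>
      forces R (UPair_fm ?U ?V (opair i0 i1 a' b')) u" if "u \<preceq> p" for u
    unfolding opair_def using e forces_eq_ext[of a a', OF _ that] forces_eq_ext[of b b', OF _ that]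
    by (intro conjI forces_UPair_upair[OF i] forces_eq_refl) simp_all
  have names: "is_name R ?U" "is_name R ?V"
    using names by (simp_all add: is_name_upair)
  show "forces R (Pair_fm a b (opair i0 i1 a' b')) p"
    unfolding forces_Pair
    by (rule dense_belowI, rule CollectI, rule exI[of _ ?U], rule exI[of _ ?V]) (use * names in simp)
qed

section \<open>Canonical names of ordinals\<close>

text \<open>
  If a condition forced the names of \<open>a < b\<close> to be equal, then that of \<open>a\<close> would be forced to be an element
  of itself, and a stronger condition would equate it with the name of some \<open>c < a\<close>: an infinite descent.
\<close>

lemma check_elem_inj:
  assumes r: "Well_order r" and ab: "a \<in> Field r" "b \<in> Field r"
    and eq: "forces_eq R (check_elem R r a) (check_elem R r b) p" and p: "p \<in> Field R"
  shows "a = b"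
proof -
  have wf: "wf (r - Id)" and tot: "Total r"
    using r by (auto simp: well_order_on_def linear_order_on_def)
  have *: "\<not> forces_eq R (check_elem R r a) (check_elem R r b) p"
    if "a \<in> underS r b" "p \<in> Field R" for a b p
    using wf that
  proof (induction a arbitrary: b p rule: wf_induct_rule)
    case (less a)
    show ?case
    proof
      assume "forces_eq R (check_elem R r a) (check_elem R r b) p"
      then have "forces_eq R (check_elem R r b) (check_elem R r a) p"
        by (rule forces_eq_symD)
      then have "forces_mem R (sub (check_elem R r b) a) (check_elem R r a) p"
        by (rule forces_eqD1) (use less.prems in \<open>simp_all add: check_elem_unfold[OF r] top_cond\<close>)
      then have "dense_below R p {u. \<exists>j\<in>underS r a. u \<preceq> top_cond R \<and>
          forces_eq R (check_elem R r a) (sub (check_elem R r a) j) u}"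
        using less.prems by (simp add: check_elem_unfold[OF r] forces_mem_def)
      then obtain u c where u: "u \<preceq> p" "c \<in> underS r a"
          "forces_eq R (check_elem R r a) (sub (check_elem R r a) c) u"
        using ext_refl[OF less.prems(2)] unfolding dense_below_def by blast
      then have "forces_eq R (check_elem R r c) (check_elem R r a) u"
        by (simp add: check_elem_unfold[OF r] forces_eq_symD)
      moreover have "(c, a) \<in> r - Id"
        using u(2) by (auto simp: underS_def)
      ultimately show False
        using less.IH u ext_Field(1) by blast
    qed
  qed
  show ?thesis
  proof (rule ccontr)
    assume "a \<noteq> b"
    then have "a \<in> underS r b \<or> b \<in> underS r a"
      using tot ab by (auto simp: total_on_def underS_def)
    then show False
      using * eq p forces_eq_symD[OF eq] by blast
  qed
qed

lemma is_name_check_elem: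
  assumes r: "Well_order r"
  shows "is_name R (check_elem R r a)"
proof -
  have "wf (r - Id)"
    using r by (auto simp: well_order_on_def)
  then show ?thesis
  proof (induction a rule: wf_induct_rule)
    case (less a)
    have "is_name R (sub (check_elem R r a) b)" if "b \<in> underS r a" for b
      using less that by (auto simp: check_elem_unfold(2)[OF r] underS_def)
    then show ?case
      by (subst is_name_iff) (simp add: check_elem_unfold(1,3)[OF r] top_cond)
  qed
qed

lemma forces_mem_check_ord:
  "forces_mem R x (check_ord R r) p \<longleftrightarrow>
     dense_below R p {u. \<exists>a\<in>Field r. forces_eq R x (check_elem R r a) u}"
proof -
  have "(\<exists>j\<in>idx (check_ord R r). u \<preceq> cond (check_ord R r) j \<and> forces_eq R x (sub (check_ord R r) j) u) \<longleftrightarrow>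
      (\<exists>a\<in>Field r. forces_eq R x (check_elem R r a) u)" if "u \<preceq> p" for u
    using top_cond(2)[OF ext_Field(1)[OF that]] by (simp add: check_ord_def)
  then show ?thesis
    unfolding forces_mem_def by (intro dense_below_cong) simp
qed

lemma check_elem_mem_check_ord:
  "a \<in> Field r \<Longrightarrow> forces_mem R (check_elem R r a) (check_ord R r) p"
  unfolding forces_mem_check_ord by (rule dense_belowI) (use forces_eq_refl in blast)

section \<open>Reading off a collapsing surjection\<close>

text \<open>
  The name of the surjection consists of the pairs of \<open>j\<close> and \<open>v j d\<close>, each with condition \<open>d\<close>, for \<open>d \<in> D j\<close>.
  Density of \<open>D j\<close> makes it total; it is single-valued because compatible conditions have the same label; and it is
  onto because every label can be reached below every condition at some \<open>j\<close>. The injection \<open>e\<close> provides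
  the indices for the elements of this name.
\<close>

lemma collapses_if_labels:
  fixes r s :: "'i rel" and e :: "'i \<times> 'p \<Rightarrow> 'i" and v :: "'i \<Rightarrow> 'p \<Rightarrow> 'i"
  assumes r: "Well_order r" and s: "Well_order s"
    and i: "(i0::'i) \<noteq> i1"
    and inj: "inj_on e (Field r \<times> Field R)"
    and D: "\<And>j. j \<in> Field r \<Longrightarrow> D j \<subseteq> Field R"
    and dense: "\<And>j p. j \<in> Field r \<Longrightarrow> p \<in> Field R \<Longrightarrow> \<exists>d\<in>D j. d \<preceq> p"
    and v: "\<And>j d. j \<in> Field r \<Longrightarrow> d \<in> D j \<Longrightarrow> v j d \<in> Field s"
    and agree: "\<And>j d d' u. j \<in> Field r \<Longrightarrow> d \<in> D j \<Longrightarrow> d' \<in> D j \<Longrightarrow> u \<preceq> d \<Longrightarrow> u \<preceq> d' \<Longrightarrow> v j d = v j d'"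
    and hit: "\<And>p \<xi>. p \<in> Field R \<Longrightarrow> \<xi> \<in> Field s \<Longrightarrow> \<exists>j\<in>Field r. \<exists>d\<in>D j. d \<preceq> p \<and> v j d = \<xi>"
  shows "collapses R s r"
proof -
  let ?C = "check_elem R r" and ?K = "check_elem R s"
  define dec where "dec = inv_into (Field r \<times> Field R) e"
  define f :: "('i, 'p) name" where
    "f = Name (e ` Sigma (Field r) D)
       (\<lambda>i. opair i0 i1 (?C (fst (dec i))) (?K (v (fst (dec i)) (snd (dec i))))) (\<lambda>i. snd (dec i))"
  have dec: "dec (e (j, d)) = (j, d)" if "j \<in> Field r" "d \<in> D j" for j d
    unfolding dec_def using that D by (intro inv_into_f_f inj) auto
  have names: "is_name R (?C a)" "is_name R (?K a)" for a
    by (simp_all add: is_name_check_elem r s)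
  have name_f: "is_name R f"
    using D by (auto simp: f_def dec is_name_opair names)
  have mem_f: "forces_mem R z f p \<longleftrightarrow> dense_below R p {u. \<exists>j\<in>Field r. \<exists>d\<in>D j. u \<preceq> d \<and>
      forces_eq R z (opair i0 i1 (?C j) (?K (v j d))) u}" for z p
    unfolding forces_mem_def by (rule dense_below_cong) (auto simp: f_def dec)
  have app: "forces R (App_fm f a b) p \<longleftrightarrow> dense_below R p {u. \<exists>j\<in>Field r. \<exists>d\<in>D j. u \<preceq> d \<and>
      forces_eq R a (?C j) u \<and> forces_eq R b (?K (v j d)) u}" (is "_ \<longleftrightarrow> dense_below R p (?E a b)")
    if ab: "is_name R a" "is_name R b" for a b :: "('i, 'p) name" and p
  proof
    assume "forces R (App_fm f a b) p"
    then show "dense_below R p (?E a b)"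
      unfolding App_fm_def forces_ExiIn
    proof (rule dense_below_bind)
      fix u assume "u \<in> {u. \<exists>z. is_name R z \<and> forces_mem R z f u \<and> forces R (Pair_fm a b z) u}"
      then obtain z where "forces_mem R z f u" and pair: "forces R (Pair_fm a b z) u"
        by blast
      from this(1) show "dense_below R u (?E a b)"
        unfolding mem_f
      proof (rule dense_below_weaken)
        fix t assume "t \<in> {u. \<exists>j\<in>Field r. \<exists>d\<in>D j. u \<preceq> d \<and>
          forces_eq R z (opair i0 i1 (?C j) (?K (v j d))) u}" and t: "t \<preceq> u"
        then obtain j d where j: "j \<in> Field r" "d \<in> D j" "t \<preceq> d"
          and z: "forces_eq R z (opair i0 i1 (?C j) (?K (v j d))) t"
          by blast
        have "forces R (Pair_fm a b (opair i0 i1 (?C j) (?K (v j d)))) t"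
          using forces_Pair_cong[OF forces_ext[OF pair t] z] .
        then have "forces_eq R a (?C j) t \<and> forces_eq R b (?K (v j d)) t"
          unfolding forces_Pair_opair[OF i ext_Field(1)[OF t] ab names] .
        with j show "t \<in> ?E a b" by blast
      qed
    qed
  next
    assume "dense_below R p (?E a b)"
    then show "forces R (App_fm f a b) p"
      unfolding App_fm_def forces_ExiIn
    proof (rule dense_below_weaken)
      fix u assume "u \<in> ?E a b" and u: "u \<preceq> p"
      then obtain j d where j: "j \<in> Field r" "d \<in> D j" "u \<preceq> d"
        and ab': "forces_eq R a (?C j) u \<and> forces_eq R b (?K (v j d)) u"
        by blast
      let ?z = "opair i0 i1 (?C j) (?K (v j d))"
      have "forces_mem R ?z f u"
        unfolding mem_f
      proof (rule dense_belowI)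
        fix t assume "t \<preceq> u"
        then have "t \<preceq> d" using j(3) by (rule ext_trans)
        with j show "t \<in> {u. \<exists>j\<in>Field r. \<exists>d\<in>D j. u \<preceq> d \<and>
            forces_eq R ?z (opair i0 i1 (?C j) (?K (v j d))) u}"
          using forces_eq_refl by blast
      qed
      moreover have "forces R (Pair_fm a b ?z) u"
        using ab' unfolding forces_Pair_opair[OF i ext_Field(1)[OF u] ab names] .
      ultimately show "u \<in> {u. \<exists>z. is_name R z \<and> forces_mem R z f u \<and> forces R (Pair_fm a b z) u}"
        using is_name_opair[OF names(1) names(2)] by blast
    qed
  qed
  have surj: "forces R (Surjection_fm f (check_ord R r) (check_ord R s)) p" if p: "p \<in> Field R" for p
    unfolding Surjection_fm_def Function_fm_def forces.simps
  proof (intro conjI)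
    show "forces R (AllIn f (\<lambda>z. ExiIn (check_ord R r) (\<lambda>a. ExiIn (check_ord R s) (\<lambda>b. Pair_fm a b z)))) p"
      unfolding forces_AllIn forces_ExiIn
    proof (intro allI impI)
      fix z :: "('i, 'p) name" and q assume "forces_mem R z f q"
      then show "dense_below R q {u. \<exists>a. is_name R a \<and> forces_mem R a (check_ord R r) u \<and>
          dense_below R u {u. \<exists>b. is_name R b \<and> forces_mem R b (check_ord R s) u \<and>
            forces R (Pair_fm a b z) u}}"
        unfolding mem_f
      proof (rule dense_below_weaken)
        fix u assume "u \<in> {u. \<exists>j\<in>Field r. \<exists>d\<in>D j. u \<preceq> d \<and>
          forces_eq R z (opair i0 i1 (?C j) (?K (v j d))) u}" and u: "u \<preceq> q"
        then obtain j d where j: "j \<in> Field r" "d \<in> D j"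
          and z: "forces_eq R z (opair i0 i1 (?C j) (?K (v j d))) u"
          by blast
        have "forces R (Pair_fm (?C j) (?K (v j d)) (opair i0 i1 (?C j) (?K (v j d)))) u"
          unfolding forces_Pair_opair[OF i ext_Field(1)[OF u] names names] by simp
        then have pair: "forces R (Pair_fm (?C j) (?K (v j d)) z) u"
          by (rule forces_Pair_cong[OF _ forces_eq_symD[OF z]])
        have "dense_below R u {u. \<exists>b. is_name R b \<and> forces_mem R b (check_ord R s) u \<and>
            forces R (Pair_fm (?C j) b z) u}"
          by (intro dense_belowI CollectI exI[of _ "?K (v j d)"] conjI names
            check_elem_mem_check_ord v[OF j] forces_ext[OF pair])
        then show "u \<in> {u. \<exists>a. is_name R a \<and> forces_mem R a (check_ord R r) u \<and>
          dense_below R u {u. \<exists>b. is_name R b \<and> forces_mem R b (check_ord R s) u \<and>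
            forces R (Pair_fm a b z) u}}"
          by (intro CollectI exI[of _ "?C j"] conjI names check_elem_mem_check_ord j(1))
      qed
    qed
  next
    show "forces R (AllIn (check_ord R r) (\<lambda>a. ExiIn (check_ord R s) (App_fm f a))) p"
      unfolding forces_AllIn forces_ExiIn
    proof (intro allI impI)
      fix a :: "('i, 'p) name" and q assume a: "is_name R a" and "forces_mem R a (check_ord R r) q"
      from this(2) show "dense_below R q {u. \<exists>b. is_name R b \<and> forces_mem R b (check_ord R s) u \<and>
          forces R (App_fm f a b) u}"
        unfolding forces_mem_check_ord[of a]
      proof (rule dense_below_bind)
        fix u assume "u \<in> {u. \<exists>j\<in>Field r. forces_eq R a (?C j) u}" and u: "u \<preceq> q"
        then obtain j where j: "j \<in> Field r" "forces_eq R a (?C j) u"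
          by blast
        show "dense_below R u {u. \<exists>b. is_name R b \<and> forces_mem R b (check_ord R s) u \<and>
            forces R (App_fm f a b) u}"
          unfolding dense_below_def
        proof (intro allI impI)
          fix t assume t: "t \<preceq> u"
          obtain d where d: "d \<in> D j" "d \<preceq> t"
            using dense[OF j(1) ext_Field(1)[OF t]] by blast
          have "forces R (App_fm f a (?K (v j d))) d"
            unfolding app[OF a names(2)]
          proof (rule dense_belowI)
            fix t' assume t': "t' \<preceq> d"
            have "forces_eq R a (?C j) t'"
              by (rule forces_eq_ext[OF j(2) ext_trans[OF t' ext_trans[OF d(2) t]]])
            with t' j(1) d(1) show "t' \<in> ?E a (?K (v j d))"
              using forces_eq_refl by blast
          qed
          then show "\<exists>u\<in>{u. \<exists>b. is_name R b \<and> forces_mem R b (check_ord R s) u \<and>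
              forces R (App_fm f a b) u}. u \<preceq> t"
            by (intro bexI[of _ d] d(2) CollectI exI[of _ "?K (v j d)"] conjI names
              check_elem_mem_check_ord v[OF j(1) d(1)])
        qed
      qed
    qed
  next
    show "forces R (AllIn (check_ord R r) (\<lambda>a. AllIn (check_ord R s) (\<lambda>b. AllIn (check_ord R s)
        (\<lambda>b'. Imp (Conj (App_fm f a b) (App_fm f a b')) (Eq b b'))))) p"
      unfolding forces_AllIn forces_Imp forces.simps
    proof (intro allI impI, elim conjE)
      fix a b b' :: "('i, 'p) name" and q
      assume ab: "is_name R a" "is_name R b" "is_name R b'"
        and b: "forces R (App_fm f a b) q" and b': "forces R (App_fm f a b') q"
      show "forces_eq R b b' q"
      proof (rule forces_eq_local, rule dense_below_bind)
        show "dense_below R q (?E a b)"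
          using b unfolding app[OF ab(1,2)] .
        fix u assume "u \<in> ?E a b" and u: "u \<preceq> q"
        then obtain j d where j: "j \<in> Field r" "d \<in> D j" "u \<preceq> d"
          and e: "forces_eq R a (?C j) u" "forces_eq R b (?K (v j d)) u"
          by blast
        have "dense_below R u (?E a b')"
          using forces_ext[OF b' u] unfolding app[OF ab(1,3)] .
        then show "dense_below R u {u. forces_eq R b b' u}"
        proof (rule dense_below_weaken)
          fix t assume "t \<in> ?E a b'" and t: "t \<preceq> u"
          then obtain j' d' where j': "j' \<in> Field r" "d' \<in> D j'" "t \<preceq> d'"
            and e': "forces_eq R a (?C j') t" "forces_eq R b' (?K (v j' d')) t"
            by blast
          have "forces_eq R (?C j) (?C j') t"
            by (rule forces_eq_trans[OF forces_eq_symD[OF forces_eq_ext[OF e(1) t]] e'(1)])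
          then have "j' = j"
            using check_elem_inj[OF r j(1) j'(1)] ext_Field(1)[OF t] by blast
          then have "v j' d' = v j d"
            using agree[OF j(1,2) _ ext_trans[OF t j(3)] j'(3)] j'(2) by simp
          then have "forces_eq R b' (?K (v j d)) t"
            using e'(2) by simp
          then show "t \<in> {u. forces_eq R b b' u}"
            using forces_eq_trans[OF forces_eq_ext[OF e(2) t] forces_eq_symD] by blast
        qed
      qed
    qed
  next
    show "forces R (AllIn (check_ord R s) (\<lambda>b. ExiIn (check_ord R r) (\<lambda>a. App_fm f a b))) p"
      unfolding forces_AllIn forces_ExiIn
    proof (intro allI impI)
      fix b :: "('i, 'p) name" and q assume b: "is_name R b" and "forces_mem R b (check_ord R s) q"
      from this(2) show "dense_below R q {u. \<exists>a. is_name R a \<and> forces_mem R a (check_ord R r) u \<and>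
          forces R (App_fm f a b) u}"
        unfolding forces_mem_check_ord[of b]
      proof (rule dense_below_bind)
        fix u assume "u \<in> {u. \<exists>\<xi>\<in>Field s. forces_eq R b (?K \<xi>) u}" and u: "u \<preceq> q"
        then obtain \<xi> where \<xi>: "\<xi> \<in> Field s" "forces_eq R b (?K \<xi>) u"
          by blast
        show "dense_below R u {u. \<exists>a. is_name R a \<and> forces_mem R a (check_ord R r) u \<and>
            forces R (App_fm f a b) u}"
          unfolding dense_below_def
        proof (intro allI impI)
          fix t assume t: "t \<preceq> u"
          obtain j d where j: "j \<in> Field r" and d: "d \<in> D j" "d \<preceq> t" and vd: "v j d = \<xi>"
            using hit[OF ext_Field(1)[OF t] \<xi>(1)] by blast
          have "forces R (App_fm f (?C j) b) d"
            unfolding app[OF names(1) b]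
          proof (rule dense_belowI)
            fix t' assume t': "t' \<preceq> d"
            have "forces_eq R b (?K (v j d)) t'"
              unfolding vd by (rule forces_eq_ext[OF \<xi>(2) ext_trans[OF t' ext_trans[OF d(2) t]]])
            with t' j d(1) show "t' \<in> ?E (?C j) b"
              using forces_eq_refl by blast
          qed
          then show "\<exists>u\<in>{u. \<exists>a. is_name R a \<and> forces_mem R a (check_ord R r) u \<and>
              forces R (App_fm f a b) u}. u \<preceq> t"
            by (intro bexI[of _ d] d(2) CollectI exI[of _ "?C j"] conjI names
              check_elem_mem_check_ord j)
        qed
      qed
    qed
  qed
  show ?thesis
    unfolding collapses_def forces_Exi
  proof (intro ballI dense_belowI CollectI exI[of _ f] conjI name_f)
    fix p u assume "u \<preceq> p"
    then show "forces R (Surjection_fm f (check_ord R r) (check_ord R s)) u"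
      using surj ext_Field(1) by blast
  qed
qed

end

section \<open>The collapse\<close>

theorem theorem1p2:
  fixes \<kappa> :: "'a rel"
    and \<kappa>s :: "nat \<Rightarrow> 'a rel"
    and P :: "nat \<Rightarrow> 'p rel"
  assumes "Card_order \<kappa>"
    and "singular_card \<kappa>"
    and "strong_limit \<kappa>"
    and "has_cofinality \<kappa> natLeq"
    and "has_cofinality |Pow (Field \<kappa>)| (cardSuc \<kappa>)"
    and "\<And>n. regular_card (\<kappa>s n)"
    and "increasing_cofinal_seq \<kappa>s \<kappa>"
    and "\<And>n. forcing_notion (P n)"
    and "\<And>n. nontrivial (P n)"
    and "\<And>n. separative (P n)"
    and "\<And>n. closed_forcing (\<kappa>s n) (P n)"
    and "\<And>n. |Field (P n)| <o \<kappa>"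
    and "\<And>n. glb_closed_forcing (\<kappa>s n) (P n)"
  shows "collapses (full_product P) |Pow (Field \<kappa>)| (cardSuc \<kappa>)"
proof -
  let ?K = "Field \<kappa>" and ?R = "full_product P" and ?r = "cardSuc \<kappa>"
  note \<kappa> = assms(1)
  have inf: "infinite ?K"
    using assms(2) by (simp add: singular_card_def cinfinite_def)
  have \<kappa>s: "Card_order (\<kappa>s n)" "infinite (Field (\<kappa>s n))" for n
    using assms(6)[of n] by (simp_all add: regular_card_def cinfinite_def)
  have \<kappa>K: "\<kappa> =o |?K|"
    by (rule ordIso_symmetric[OF card_of_Field_ordIso[OF \<kappa>]])
  obtain C where C: "\<And>m n. m \<le> n \<Longrightarrow> C m \<subseteq> C n" "(\<Union>n. C n) = ?K" "\<And>n. |Pow (C n)| <o \<kappa>s n"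
    using strong_limit_filtration[OF \<kappa> assms(3) \<kappa>s assms(7)] by blast
  have \<kappa>s_mono: "\<kappa>s m \<le>o \<kappa>s n" if "m \<le> n" for m n
  proof (cases "m = n")
    case True
    then show ?thesis using \<kappa>s(1)[of n] by (simp add: card_order_on_def ordLeq_reflexive)
  next
    case False
    then show ?thesis
      using assms(7) that by (auto simp: increasing_cofinal_seq_def intro: ordLess_imp_ordLeq)
  qed
  have \<kappa>s_K: "\<kappa>s n \<le>o |?K|" for n
    by (rule ordLeq_ordIso_trans[OF ordLess_imp_ordLeq \<kappa>K])
      (use assms(7) in \<open>simp add: increasing_cofinal_seq_def\<close>)
  interpret product P \<kappa>s ?K C
    by unfold_locales (fact assms inf C \<kappa>s_mono \<kappa>s_K)+
  interpret R: forcing ?R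
    by unfold_locales (rule forcing_notion_full_product[OF assms(8)])
  have FR: "Field ?R = Conds"
    unfolding Field_full_product[OF assms(8)] Conds_def ..
  have R_tail: "?R = tail 0"
    by (auto simp: full_product_def tail_def Conds_def intro: FieldI1 FieldI2)
  have card: "|Conds| \<le>o |Pow ?K|"
    unfolding Conds_def
  proof (rule card_of_countable_product[OF inf])
    show "|Field (P n)| \<le>o |?K|" for n
      by (rule ordLeq_ordIso_trans[OF ordLess_imp_ordLeq[OF assms(12)] \<kappa>K])
  qed
  have r: "Card_order ?r" by (rule cardSuc_Card_order[OF \<kappa>])
  have small: "|underS ?r j| \<le>o |?K|" if "j \<in> Field ?r" for j
  proof -
    have "|underS ?r j| \<le>o \<kappa>"
      using card_of_underS[OF r that] cardSuc_ordLeq_ordLess[OF \<kappa> card_of_Card_order] by blast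
    then show ?thesis using \<kappa>K by (rule ordLeq_ordIso_trans)
  qed
  have bounded: "\<exists>j\<in>Field ?r. J \<subseteq> underS ?r j" if J: "J \<subseteq> Field ?r" "|J| \<le>o |?K|" for J
    by (rule bounded_in_cardSuc[OF \<kappa> inf J(1) ordLeq_ordIso_trans[OF J(2) ordIso_symmetric[OF \<kappa>K]]]) blast
  obtain D v where labels: "\<forall>j\<in>Field ?r. dense_open (D j)" "\<forall>j p. v j p \<subseteq> ?K"
    "\<forall>j\<in>Field ?r. \<forall>p\<in>D j. \<forall>q. q \<preceq>\<^sup>* p \<longrightarrow> v j q = v j p"
    "\<forall>p\<in>Conds. \<forall>X\<in>Pow ?K. \<exists>j\<in>Field ?r. \<exists>d\<in>D j. d \<preceq>\<^sup>* p \<and> v j d = X"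
    by (rule collapsing_labels[OF r small bounded assms(5) card]; assumption?)
  note D = labels(1)[rule_format] and v = labels(2)[rule_format] and agree = labels(3)[rule_format]
    and hit = labels(4)[rule_format, OF _ PowI]
  \<comment> \<open>The names of the forcing language are indexed by the type of sets, which is large enough for all pairs of an ordinal below \<open>\<kappa>\<^sup>+\<close> and a condition.\<close>
  have "infinite (UNIV :: 'a set set)"
    using inf infinite_super[OF subset_UNIV inf] by (simp add: Finite_Set.finite_set)
  then have "|Field ?r \<times> Field ?R| \<le>o |UNIV :: 'a set set|"
    unfolding FR
    by (intro card_of_Times_ordLeq_infinite_Field ordLeq_transitive[OF card card_of_mono1])
      (simp_all add: Field_card_of card_of_card_order_on card_of_mono1)
  then obtain e :: "'a set \<times> (nat \<Rightarrow> 'p) \<Rightarrow> 'a set" where e: "inj_on e (Field ?r \<times> Field ?R)"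
    unfolding card_of_ordLeq[symmetric] by blast
  \<comment> \<open>Labels are reached by almost stronger conditions; a finite change makes these stronger without affecting the label.\<close>
  have below: "\<exists>d'\<in>D j. (d', p) \<in> ?R \<and> v j d' = v j d" if jd: "j \<in> Field ?r" "d \<in> D j" "d \<preceq>\<^sup>* p" for j d p
  proof -
    obtain d' where d': "(d', p) \<in> tail 0" "d' \<preceq>\<^sup>* d"
      using almost_modify[OF jd(3)] by blast
    then have "d' \<in> D j" using D[OF jd(1)] jd(2) by (auto simp: dense_open_def)
    then show ?thesis
      using d'(1) agree[OF jd(1,2) d'(2)] unfolding R_tail by blast
  qed
  show ?thesis
  proof (rule R.collapses_if_labels[where e = e and D = D and v = v and ?i0.0 = "{}" and ?i1.0 = UNIV, OF _ _ _ e])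
    show "Well_order ?r" using r by (simp add: card_order_on_def)
    show "Well_order |Pow ?K|" by (rule card_of_Well_order)
    show "({} :: 'a set) \<noteq> UNIV" by simp
    show "D j \<subseteq> Field ?R" if "j \<in> Field ?r" for j
      using D[OF that] by (simp add: FR dense_open_def)
    show "\<exists>d\<in>D j. (d, p) \<in> ?R" if j: "j \<in> Field ?r" and p: "p \<in> Field ?R" for j p
    proof -
      obtain d where "d \<in> D j" "d \<preceq>\<^sup>* p"
        using D[OF j] p by (auto simp: FR dense_open_def)
      then show ?thesis using below[OF j] by blast
    qed
    show "v j d \<in> Field |Pow ?K|" for j d
      using v by (simp add: Field_card_of)
    show "v j d = v j d'"
      if "j \<in> Field ?r" "d \<in> D j" "d' \<in> D j" "(u, d) \<in> ?R" "(u, d') \<in> ?R" for j d d' u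
      using agree[OF that(1,2) tail_imp_almost] agree[OF that(1,3) tail_imp_almost] that(4,5)
      unfolding R_tail by metis
    show "\<exists>j\<in>Field ?r. \<exists>d\<in>D j. (d, p) \<in> ?R \<and> v j d = X"
      if "p \<in> Field ?R" "X \<in> Field |Pow ?K|" for p X
    proof -
      have "p \<in> Conds" "X \<subseteq> ?K" using that by (simp_all add: FR Field_card_of)
      then obtain j d where j: "j \<in> Field ?r" "d \<in> D j" "d \<preceq>\<^sup>* p" "v j d = X" using hit by blast
      then show ?thesis using below[OF j(1-3)] by blast
    qed
  qed
qed

end
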